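(* Let $\Gamma$ be a tropical curve with model $(G=(V,E),\ell)$, let $\flat\in V$, and let $T=(V,F)$ be a spanning tree of $G$, with $F^c=E\setminus F$. Then the tropical Ceresa class of $\Gamma$ based at $\flat$ is $$\mathbf v_\flat(\Gamma)=\sum_{e\in F,\ \varepsilon\in F^c}\mathrm{sgn}^\flat_T(e,\varepsilon)\,\ell(e)\;\mathsf a_\varepsilon\otimes(\mathsf b_\varepsilon\wedge\mathsf b_e)\qquad\text{in }\ \mathrm{JH}_{2,1}(\mathrm{Jac}(\Gamma)).$$
   Context: $\Gamma$ is a connected tropical curve (compact metric graph) of genus (first Betti number) $g\ge2$ with model $(G,\ell)$: $G=(V,E)$ a finite connected graph, $\ell\colon E\to\mathbb R_{>0}$. Edges are oriented; $s_e$, $t_e$ are source and target of $e$. One assumes $G$ has no separating edges (the maps to the Jacobian below contract them). **Jacobian.** $H_{\mathbb Z}=\mathrm H_1(\Gamma,\mathbb Z)$. $\Omega_{\mathbb Z}$ is the group of integral harmonic $1$-forms: functions $\omega\colon E\to\mathbb Z$ with $\sum_{s_e=v}\omega(e)=\sum_{t_e=v}\omega(e)$ for all $v\in V$; $\Omega=\Omega_{\mathbb Z}\otimes\mathbb R$. For a path or $1$-chain $\gamma$ in $\Gamma$, $\mathbf I_\gamma\in\Omega^\vee$ is $\omega\mapsto\int_\gamma\omega$, so $\mathbf I_e(\omega)=\ell(e)\omega(e)$. Via $\gamma\mapsto\mathbf I_\gamma$, $H_{\mathbb Z}$ is a full-rank lattice in $\Omega^\vee$, and $\mathrm{Jac}(\Gamma)=\Omega^\vee/H_{\mathbb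 Z}$, a tropical variety with tangent spaces $\Omega^\vee$ and integral affine structure given by the lattice $\Omega_{\mathbb Z}^\vee\subset\Omega^\vee$. **Homology of the Jacobian.** $\mathrm C_{p,q}(\mathrm{Jac}(\Gamma),\mathbb R)$, resp. $\mathrm C_{p,q}(\mathrm{Jac}(\Gamma),\mathbb Z)$, are (polyhedral) $q$-chains on $\mathrm{Jac}(\Gamma)$ with coefficients in $\bigwedge^p\Omega^\vee$, resp. $\bigwedge^p\Omega^\vee_{\mathbb Z}$, written as sums of $[P,v]$. Homology: $\mathrm H_{p,q}(\mathrm{Jac}(\Gamma),\mathbb R)=\bigwedge^qH\otimes\bigwedge^p\Omega^\vee$ with $H=H_{\mathbb Z}\otimes\mathbb R$, and similarly over $\mathbb Z$ with $H_{\mathbb Z}$, $\Omega_{\mathbb Z}^\vee$. The monodromy operator is $\mathrm N([P,v])=\sum_Q\mathrm{sgn}(P,Q)[Q,(o_P-o_Q)\wedge v]$ over facets $Q$ of $P$, where $\mathrm{sgn}(P,Q)$ is the sign of $Q$ in $\partial P$, $o_P\in P$ are chosen points of the cells, and $o_P-o_Q\in\Omega^\vee$ is computed in a lift to the universal cover. It commutes with $\partial$. Set $\mathrm L_{2,1}=\mathrm N(\mathrm H_{1,2}(\mathrm{Jac}(\Gamma),\mathbb Z))$ (the subgroup generated by the elements $a\otimes(a'\wedge b)-a'\otimes(a\wedge b)$ for $a,a'\in H_{\mathbb Z}$, $b\in\Omega_{\mathbb Z}^\vee$) and $\mathrm{JH}_{2,1}(\mathrm{Jac}(\Gamma))=\mathrm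 H_{2,1}(\mathrm{Jac}(\Gamma),\mathbb R)/\mathrm L_{2,1}$. **Ceresa class.** $\Gamma_\flat$ and $\Gamma_\flat^-$ are the images of $\Gamma$ in $\mathrm{Jac}(\Gamma)$ under $x\mapsto\mathbf I_{\gamma_x}$ and $x\mapsto-\mathbf I_{\gamma_x}$, $\gamma_x$ a path from $\flat$ to $x$; they are tropical $1$-cycles (weights $1$). The fundamental chain of a tropical $1$-cycle is the sum of $[P,\mathfrak v_P]$, $P$ running over its oriented edges and $\mathfrak v_P$ the primitive integral tangent vector in the direction of $P$. The Ceresa cycle is $\nu_\flat(\Gamma)=[\Gamma_\flat]-[\Gamma^-_\flat]$; it is null-homologous. The Ceresa class is $\mathbf v_\flat(\Gamma)=\mathrm{AJ}(\nu_\flat(\Gamma))$: the class in $\mathrm{JH}_{2,1}(\mathrm{Jac}(\Gamma))$ of $\mathrm N(\xi)$ for any $\xi\in\mathrm C_{1,2}(\mathrm{Jac}(\Gamma),\mathbb Z)$ whose boundary is the fundamental chain of $\nu_\flat(\Gamma)$ (independent of choices). **Notation in the formula.** $\mathsf b_e=\mathbf I_e/\ell(e)\in\Omega_{\mathbb Z}^\vee$, i.e. $\omega\mapsto\omega(e)$, for $e\in E$. For $\varepsilon\in F^c$, $\mathsf a_\varepsilon\in H_{\mathbb Z}$ is the class of the unique cycle contained in $T\cup\varepsilon$, oriented along $\varepsilon$. For $e\in F$, $\varepsilon\in F^c$, consider the paths in $T$ from $\flat$ to $s_\varepsilon$ and to $t_\varepsilon$. Then $\mathrm{sgn}_T^\flat(e,\varepsilon)=\pm2$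 if $e$ lies on both paths, $\pm1$ if $e$ lies on exactly one of them, and $0$ if on neither; the sign is $+$ if $e$ is oriented away from $\flat$ and $-$ if $e$ is oriented towards $\flat$. *)

theory Defs
  imports
    "HOL-Analysis.Analysis"
    "HOL-Library.Function_Algebras"
    "HOL-Library.Poly_Mapping"
    "HOL-Algebra.Coset"
    "Graph_Theory.Digraph_Component"
begin

text \<open>
  Forms, functionals and bivectors are all represented by functions, so the pointwise real
  vector space structure is needed (\<open>HOL-Library\<close> only supplies the additive part).
\<close>

instantiation "fun" :: (type, real_vector) real_vector
begin

definition scaleR_fun :: "real \<Rightarrow> ('a \<Rightarrow> 'b) \<Rightarrow> 'a \<Rightarrow> 'b" where
  "scaleR_fun c f = (\<lambda>x. c *\<^sub>R f x)"

instance
  by standard (auto simp: scaleR_fun_def fun_eq_iff plus_fun_def scaleR_add_right scaleR_add_left)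

end


section \<open>Graphs, walks and spanning trees\<close>

text \<open>
  A model \<open>(G, len)\<close> is a finite multigraph (loops and parallel edges allowed) whose edges carry
  an auxiliary orientation from \<^const>\<open>tail\<close> to \<^const>\<open>head\<close>. Walks may traverse edges
  against this orientation: a step \<open>(e, True)\<close> goes from the tail of \<open>e\<close> to its head, a step
  \<open>(e, False)\<close> goes from the head to the tail.

  The library's \<^const>\<open>forest\<close> and \<^const>\<open>spanning_tree\<close> only exclude
  \<^emph>\<open>directed\<close> cycles, so they are not the notions wanted here.
\<close>

fun step_start :: "('v, 'e) pre_digraph \<Rightarrow> 'e \<times> bool \<Rightarrow> 'v" where
  "step_start G (e, d) = (if d then tail G e else head G e)"

fun step_end :: "('v, 'e) pre_digraph \<Rightarrow> 'e \<times> bool \<Rightarrow> 'v" where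
  "step_end G (e, d) = (if d then head G e else tail G e)"

fun is_walk :: "('v, 'e) pre_digraph \<Rightarrow> 'e set \<Rightarrow> 'v \<Rightarrow> ('e \<times> bool) list \<Rightarrow> 'v \<Rightarrow> bool" where
  "is_walk G F u [] v \<longleftrightarrow> u = v \<and> u \<in> verts G"
| "is_walk G F u (s # p) v \<longleftrightarrow> fst s \<in> F \<and> step_start G s = u \<and> is_walk G F (step_end G s) p v"

definition is_simple_path ::
    "('v, 'e) pre_digraph \<Rightarrow> 'e set \<Rightarrow> 'v \<Rightarrow> ('e \<times> bool) list \<Rightarrow> 'v \<Rightarrow> bool" where
  "is_simple_path G F u p v \<longleftrightarrow> is_walk G F u p v \<and> distinct (u # map (step_end G) p)"

definition is_cycle :: "('v, 'e) pre_digraph \<Rightarrow> 'e set \<Rightarrow> ('e \<times> bool) list \<Rightarrow> bool" where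
  "is_cycle G F p \<longleftrightarrow> p \<noteq> [] \<and> (\<exists>u. is_walk G F u p u) \<and>
     distinct (map (step_end G) p) \<and> distinct (map fst p)"

definition is_spanning_tree :: "('v, 'e) pre_digraph \<Rightarrow> 'e set \<Rightarrow> bool" where
  "is_spanning_tree G F \<longleftrightarrow> F \<subseteq> arcs G \<and>
     Digraph_Component.connected (G\<lparr>arcs := F\<rparr>) \<and> \<not> (\<exists>p. is_cycle G F p)"

definition tree_path :: "('v, 'e) pre_digraph \<Rightarrow> 'e set \<Rightarrow> 'v \<Rightarrow> 'v \<Rightarrow> ('e \<times> bool) list" where
  "tree_path G F u v = (THE p. is_simple_path G F u p v)"

definition on_tree_path :: "('v, 'e) pre_digraph \<Rightarrow> 'e set \<Rightarrow> 'v \<Rightarrow> 'e \<Rightarrow> 'v \<Rightarrow> bool" where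
  "on_tree_path G F u e v \<longleftrightarrow> e \<in> fst ` set (tree_path G F u v)"

text \<open>
  An edge \<open>e\<close> of the tree is oriented away from \<open>b\<close> iff its tail is the end nearer to \<open>b\<close>, i.e.
  iff the tree path from \<open>b\<close> to the tail of \<open>e\<close> avoids \<open>e\<close>.
\<close>

definition oriented_away :: "('v, 'e) pre_digraph \<Rightarrow> 'e set \<Rightarrow> 'v \<Rightarrow> 'e \<Rightarrow> bool" where
  "oriented_away G F b e \<longleftrightarrow> \<not> on_tree_path G F b e (tail G e)"

definition tree_sign :: "('v, 'e) pre_digraph \<Rightarrow> 'e set \<Rightarrow> 'v \<Rightarrow> 'e \<Rightarrow> 'e \<Rightarrow> real" where
  "tree_sign G F b e \<epsilon> =
     (if oriented_away G F b e then 1 else - 1) *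
     (if on_tree_path G F b e (tail G \<epsilon>) \<and> on_tree_path G F b e (head G \<epsilon>) then 2
      else if on_tree_path G F b e (tail G \<epsilon>) \<or> on_tree_path G F b e (head G \<epsilon>) then 1
      else 0)"


section \<open>Cycles, harmonic forms and genus\<close>

text \<open>
  \<open>H1_int\<close> is the kernel of the boundary map on integral simplicial 1-chains of \<open>G\<close>. As sets of
  functions \<open>H1_int\<close> and \<open>harmonic_int\<close> coincide; they play dual roles.
\<close>

definition H1_int :: "('v, 'e) pre_digraph \<Rightarrow> ('e \<Rightarrow> int) set" where
  "H1_int G = {\<gamma>. (\<forall>e. e \<notin> arcs G \<longrightarrow> \<gamma> e = 0) \<and>
     (\<forall>v\<in>verts G. (\<Sum>e | e \<in> arcs G \<and> head G e = v. \<gamma> e) -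
                   (\<Sum>e | e \<in> arcs G \<and> tail G e = v. \<gamma> e) = 0)}"

definition harmonic_int :: "('v, 'e) pre_digraph \<Rightarrow> ('e \<Rightarrow> int) set" where
  "harmonic_int G = {\<omega>. (\<forall>e. e \<notin> arcs G \<longrightarrow> \<omega> e = 0) \<and>
     (\<forall>v\<in>verts G. (\<Sum>e | e \<in> arcs G \<and> tail G e = v. \<omega> e) =
                   (\<Sum>e | e \<in> arcs G \<and> head G e = v. \<omega> e))}"

type_synonym 'e form = "'e \<Rightarrow> real"

definition Omega_int :: "('v, 'e) pre_digraph \<Rightarrow> 'e form set" where
  "Omega_int G = {(\<lambda>e. of_int (\<omega> e)) | \<omega>. \<omega> \<in> harmonic_int G}"

definition Omega :: "('v, 'e) pre_digraph \<Rightarrow> 'e form set" where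
  "Omega G = span (Omega_int G)"

definition genus :: "('v, 'e) pre_digraph \<Rightarrow> nat" where
  "genus G = dim {(\<lambda>e. real_of_int (\<gamma> e)) | \<gamma>. \<gamma> \<in> H1_int G}"

locale tropical_curve = fin_digraph G for G :: "('v, 'e) pre_digraph" +
  fixes len :: "'e \<Rightarrow> real"
  assumes connected: "Digraph_Component.connected G"
    and len_pos: "\<And>e. e \<in> arcs G \<Longrightarrow> len e > 0"
    and no_separating_edge: "\<And>e. e \<in> arcs G \<Longrightarrow> Digraph_Component.connected (del_arc e)"
    and genus_ge_2: "genus G \<ge> 2"


section \<open>The dual space and the period lattice\<close>

text \<open>
  A functional on \<^const>\<open>Omega\<close> is represented by its extension by zero to all functions on the
  edges, so that equality of functionals is equality of functions.
\<close>

type_synonym 'e covec = "'e form \<Rightarrow> real"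
type_synonym 'e bivec = "'e form \<Rightarrow> 'e form \<Rightarrow> real"

definition Omega_dual :: "('v, 'e) pre_digraph \<Rightarrow> 'e covec set" where
  "Omega_dual G = {\<phi>. (\<forall>\<omega>\<in>Omega G. \<forall>\<eta>\<in>Omega G. \<phi> (\<omega> + \<eta>) = \<phi> \<omega> + \<phi> \<eta>) \<and>
     (\<forall>c. \<forall>\<omega>\<in>Omega G. \<phi> (c *\<^sub>R \<omega>) = c * \<phi> \<omega>) \<and> (\<forall>\<omega>. \<omega> \<notin> Omega G \<longrightarrow> \<phi> \<omega> = 0)}"

definition Omega_dual_int :: "('v, 'e) pre_digraph \<Rightarrow> 'e covec set" where
  "Omega_dual_int G = {\<phi> \<in> Omega_dual G. \<forall>\<omega>\<in>Omega_int G. \<phi> \<omega> \<in> \<int>}"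

definition b_edge :: "('v, 'e) pre_digraph \<Rightarrow> 'e \<Rightarrow> 'e covec" where
  "b_edge G e = (\<lambda>\<omega>. if \<omega> \<in> Omega G then \<omega> e else 0)"

text \<open>
  The exterior square of the dual is realised inside the bilinear forms on \<^const>\<open>Omega\<close>:
  \<open>\<alpha> \<and> \<beta>\<close> is the alternating form \<open>(\<omega>, \<eta>) \<mapsto> \<alpha>(\<omega>) \<beta>(\<eta>) - \<alpha>(\<eta>) \<beta>(\<omega>)\<close>.
\<close>

definition wedge :: "'e covec \<Rightarrow> 'e covec \<Rightarrow> 'e bivec" where
  "wedge \<alpha> \<beta> = (\<lambda>\<omega> \<eta>. \<alpha> \<omega> * \<beta> \<eta> - \<alpha> \<eta> * \<beta> \<omega>)"

definition wedge2_dual :: "('v, 'e) pre_digraph \<Rightarrow> 'e bivec set" where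
  "wedge2_dual G = span {wedge \<alpha> \<beta> | \<alpha> \<beta>. \<alpha> \<in> Omega_dual G \<and> \<beta> \<in> Omega_dual G}"

context tropical_curve
begin

definition I_edge :: "'e \<Rightarrow> 'e covec" where
  "I_edge e = len e *\<^sub>R b_edge G e"

definition I_chain :: "('e \<Rightarrow> int) \<Rightarrow> 'e covec" where
  "I_chain \<gamma> = (\<Sum>e\<in>arcs G. of_int (\<gamma> e) *\<^sub>R I_edge e)"

definition I_walk :: "('e \<times> bool) list \<Rightarrow> 'e covec" where
  "I_walk p = (\<Sum>(e, d)\<leftarrow>p. if d then I_edge e else - I_edge e)"

definition period_lattice :: "'e covec set" where
  "period_lattice = I_chain ` H1_int G"

text \<open>
  The cycle contained in the tree together with \<open>\<epsilon>\<close> runs along \<open>\<epsilon>\<close> and then returns inside the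
  tree.
\<close>

definition a_cycle :: "'e set \<Rightarrow> 'e \<Rightarrow> 'e covec" where
  "a_cycle F \<epsilon> = I_walk ((\<epsilon>, True) # tree_path G F (head G \<epsilon>) (tail G \<epsilon>))"


section \<open>Chains on the Jacobian\<close>

text \<open>
  The cells are affine simplices with ordered vertices, mapped to the torus
  \<open>Jac = Omega_dual / period_lattice\<close>. Such a cell is given by a list of \<open>q + 1\<close> vertices in the
  universal cover, up to a common translation by a period: \<open>jac_cell xs\<close> is the set of all lifts
  of the cell with lift \<open>xs\<close>. Degenerate simplices are allowed, and chains are not identified
  under subdivision or reordering of the vertices; this computes the same homology.
  The chain \<open>[P, v]\<close> is \<open>Poly_Mapping.single P v\<close>.
\<close>

definition jac_cell :: "'e covec list \<Rightarrow> 'e covec list set" where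
  "jac_cell xs = {map (\<lambda>x. h + x) xs | h. h \<in> period_lattice}"

definition jac_cells :: "nat \<Rightarrow> 'e covec list set set" where
  "jac_cells q = {jac_cell xs | xs. length xs = Suc q \<and> set xs \<subseteq> Omega_dual G}"

definition chains :: "nat \<Rightarrow> 'c set \<Rightarrow> ('e covec list set \<Rightarrow>\<^sub>0 'c::real_vector) set" where
  "chains q A = {c. Poly_Mapping.keys c \<subseteq> jac_cells q \<and> (\<forall>P. Poly_Mapping.lookup c P \<in> A)}"

definition drop_vertex :: "nat \<Rightarrow> 'e covec list \<Rightarrow> 'e covec list" where
  "drop_vertex i xs = take i xs @ drop (Suc i) xs"

definition facet :: "nat \<Rightarrow> 'e covec list set \<Rightarrow> 'e covec list set" where
  "facet i P = drop_vertex i ` P"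

text \<open>Below, \<open>boundary q\<close> is the boundary map on \<open>q\<close>-chains for \<open>q \<ge> 1\<close>.\<close>

definition boundary ::
    "nat \<Rightarrow> ('e covec list set \<Rightarrow>\<^sub>0 'c::real_vector) \<Rightarrow> ('e covec list set \<Rightarrow>\<^sub>0 'c)" where
  "boundary q c = (\<Sum>P\<in>Poly_Mapping.keys c. \<Sum>i\<le>q.
     Poly_Mapping.single (facet i P) ((-1) ^ i *\<^sub>R Poly_Mapping.lookup c P))"

text \<open>
  A choice of a point in every cell, described on lifts: \<open>pt xs\<close> is the chosen point of the
  simplex with vertices \<open>xs\<close>, and it moves along with the lift.
\<close>

definition cell_points :: "('e covec list \<Rightarrow> 'e covec) \<Rightarrow> bool" where
  "cell_points pt \<longleftrightarrow> (\<forall>xs. xs \<noteq> [] \<and> set xs \<subseteq> Omega_dual G \<longrightarrow>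
     pt xs \<in> convex hull (set xs) \<and>
     (\<forall>h\<in>period_lattice. pt (map (\<lambda>x. h + x) xs) = h + pt xs))"

text \<open>The vector \<open>o_P - o_Q\<close> for the \<open>i\<close>-th facet \<open>Q\<close> of \<open>P\<close>; it does not depend on the lift.\<close>

definition displacement ::
    "('e covec list \<Rightarrow> 'e covec) \<Rightarrow> 'e covec list set \<Rightarrow> nat \<Rightarrow> 'e covec" where
  "displacement pt P i = (let xs = (SOME xs. xs \<in> P) in pt xs - pt (drop_vertex i xs))"

definition monodromy ::
    "('e covec list \<Rightarrow> 'e covec) \<Rightarrow> nat \<Rightarrow> ('e covec list set \<Rightarrow>\<^sub>0 'e covec) \<Rightarrow>
     ('e covec list set \<Rightarrow>\<^sub>0 'e bivec)" where
  "monodromy pt q c = (\<Sum>P\<in>Poly_Mapping.keys c. \<Sum>i\<le>q.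
     Poly_Mapping.single (facet i P)
       ((-1) ^ i *\<^sub>R wedge (displacement pt P i) (Poly_Mapping.lookup c P)))"


section \<open>Homology and the intermediate Jacobian\<close>

definition cycles ::
    "nat \<Rightarrow> 'c set \<Rightarrow> ('e covec list set \<Rightarrow>\<^sub>0 'c::real_vector) set" where
  "cycles q A = {c \<in> chains q A. boundary q c = 0}"

definition cycle_group_21 :: "('e covec list set \<Rightarrow>\<^sub>0 'e bivec) monoid" where
  "cycle_group_21 = \<lparr>carrier = cycles 1 (wedge2_dual G), monoid.mult = (+), one = 0\<rparr>"

definition boundaries_21 :: "('e covec list set \<Rightarrow>\<^sub>0 'e bivec) set" where
  "boundaries_21 = boundary 2 ` chains 2 (wedge2_dual G)"

definition H21 :: "('e covec list set \<Rightarrow>\<^sub>0 'e bivec) set monoid" where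
  "H21 = cycle_group_21 Mod boundaries_21"

definition H21_class ::
    "('e covec list set \<Rightarrow>\<^sub>0 'e bivec) \<Rightarrow> ('e covec list set \<Rightarrow>\<^sub>0 'e bivec) set" where
  "H21_class c = boundaries_21 #>\<^bsub>cycle_group_21\<^esub> c"

text \<open>
  The monodromy operator on chains depends on the chosen points \<open>pt\<close>, hence the parameter, but
  the operator induced on homology does not.
\<close>

definition L21 ::
    "('e covec list \<Rightarrow> 'e covec) \<Rightarrow> ('e covec list set \<Rightarrow>\<^sub>0 'e bivec) set set" where
  "L21 pt = {H21_class (monodromy pt 2 \<xi>) | \<xi>. \<xi> \<in> cycles 2 (Omega_dual_int G)}"

definition JH21 ::
    "('e covec list \<Rightarrow> 'e covec) \<Rightarrow> ('e covec list set \<Rightarrow>\<^sub>0 'e bivec) set set monoid" where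
  "JH21 pt = H21 Mod L21 pt"

definition JH21_class ::
    "('e covec list \<Rightarrow> 'e covec) \<Rightarrow> ('e covec list set \<Rightarrow>\<^sub>0 'e bivec) set \<Rightarrow>
     ('e covec list set \<Rightarrow>\<^sub>0 'e bivec) set set" where
  "JH21_class pt h = L21 pt #>\<^bsub>H21\<^esub> h"

text \<open>
  For a period \<open>a\<close> and a bivector \<open>w\<close>, the class \<open>a \<otimes> w\<close> in
  \<open>H_{2,1} = H_1(Jac, \<int>) \<otimes> \<And>\<^sup>2 Omega_dual\<close> is represented by the image in the torus of the
  segment from \<open>0\<close> to \<open>a\<close>, with coefficient \<open>w\<close>.
\<close>

definition tensor_cycle :: "'e covec \<Rightarrow> 'e bivec \<Rightarrow> ('e covec list set \<Rightarrow>\<^sub>0 'e bivec)" where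
  "tensor_cycle a w = Poly_Mapping.single (jac_cell [0, a]) w"


section \<open>The Ceresa class\<close>

text \<open>
  A point at distance \<open>t\<close> from the tail of \<open>e\<close> is mapped to \<open>\<sigma> (I_walk p + t b_edge e)\<close>, where
  \<open>p\<close> leads from \<open>b\<close> to that tail, and \<open>\<sigma> = 1\<close> or \<open>\<sigma> = - 1\<close>. So \<open>e\<close> is mapped to the following
  segment. Different choices of \<open>p\<close> give the different lifts of the same segment in the Jacobian.
  The parameter \<open>\<sigma>\<close> also selects between the curve and its negative in \<open>fundamental_chain\<close>.
\<close>

definition curve_edge :: "real \<Rightarrow> 'v \<Rightarrow> 'e \<Rightarrow> 'e covec list set" where
  "curve_edge \<sigma> b e =
     {[\<sigma> *\<^sub>R I_walk p, \<sigma> *\<^sub>R (I_walk p + I_edge e)] | p. is_walk G (arcs G) b p (tail G e)}"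

definition direction :: "'e covec list set \<Rightarrow> 'e covec" where
  "direction P = (THE d. \<exists>x y. [x, y] \<in> P \<and> d = y - x)"

definition is_primitive :: "'e covec \<Rightarrow> bool" where
  "is_primitive v \<longleftrightarrow> v \<in> Omega_dual_int G \<and> v \<noteq> 0 \<and>
     (\<forall>w\<in>Omega_dual_int G. \<forall>k::int. v = of_int k *\<^sub>R w \<longrightarrow> \<bar>k\<bar> = 1)"

definition primitive_tangent :: "'e covec list set \<Rightarrow> 'e covec" where
  "primitive_tangent P = (THE v. is_primitive v \<and> (\<exists>c>0. direction P = c *\<^sub>R v))"

definition fundamental_chain :: "real \<Rightarrow> 'v \<Rightarrow> ('e covec list set \<Rightarrow>\<^sub>0 'e covec)" where
  "fundamental_chain \<sigma> b = (\<Sum>e\<in>arcs G.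
     Poly_Mapping.single (curve_edge \<sigma> b e) (primitive_tangent (curve_edge \<sigma> b e)))"

definition ceresa_cycle :: "'v \<Rightarrow> ('e covec list set \<Rightarrow>\<^sub>0 'e covec)" where
  "ceresa_cycle b = fundamental_chain 1 b - fundamental_chain (- 1) b"

definition ceresa_class ::
    "('e covec list \<Rightarrow> 'e covec) \<Rightarrow> 'v \<Rightarrow> ('e covec list set \<Rightarrow>\<^sub>0 'e bivec) set set" where
  "ceresa_class pt b = (THE c. c \<in> carrier (JH21 pt) \<and> (\<exists>\<xi>\<in>chains 2 (Omega_dual_int G).
     boundary 2 \<xi> = ceresa_cycle b \<and> c = JH21_class pt (H21_class (monodromy pt 2 \<xi>))))"

end

end

theory Submission
  imports Defs
begin

text \<open>
  Write \<open>x\<^sub>v\<close> for the lift of the vertex \<open>v\<close> to the universal cover along the tree path from the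
  base point, and \<open>a\<^sub>e = x\<^sub>s + I\<^sub>e - x\<^sub>t\<close> for an edge \<open>e\<close> from \<open>s\<close> to \<open>t\<close>; this period is \<open>0\<close> on the tree
  and the fundamental cycle of \<open>e\<close> off the tree. The Ceresa cycle is the sum over all edges of
  \<open>[x\<^sub>s, x\<^sub>s + I\<^sub>e] + [- x\<^sub>s, - x\<^sub>s - I\<^sub>e]\<close>, with coefficient \<open>b\<^sub>e\<close> on both segments.

  It is filled edge by edge (\<open>edge_filling\<close>). Coning off from \<open>0\<close> replaces the segment of \<open>e\<close> by
  \<open>[0, x\<^sub>s + I\<^sub>e] - [0, x\<^sub>s]\<close>; since \<open>x\<^sub>s + I\<^sub>e = a\<^sub>e + x\<^sub>t\<close>, one more triangle replaces \<open>[0, x\<^sub>s + I\<^sub>e]\<close>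
  by the loop \<open>[0, a\<^sub>e]\<close> and \<open>[0, x\<^sub>t]\<close>. The segments \<open>[0, x\<^sub>v]\<close> cancel in the sum over the edges
  because forms are harmonic (\<open>vertex_terms_cancel\<close>), and the loops \<open>a\<^sub>e\<close> and \<open>- a\<^sub>e\<close> of the curve and
  of its negative cancel each other up to a boundary.

  The monodromy of this filling is simplest when the chosen point of every cell is its last vertex.
  Then only the facet of a triangle that omits the last vertex counts
  (\<open>monodromy_last_triangle\<close>). The cones give nothing, since \<open>I\<^sub>e\<close> is parallel to \<open>b\<^sub>e\<close>, and the
  other triangles give \<open>a\<^sub>e \<otimes> (b\<^sub>e \<and> (a\<^sub>e + 2 x\<^sub>t)) = a\<^sub>e \<otimes> (b\<^sub>e \<and> (x\<^sub>s + x\<^sub>t))\<close> up to boundaries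
  (\<open>monodromy_edge_filling\<close>). Finally, \<open>x\<^sub>s + x\<^sub>t\<close> is a combination of the vectors \<open>I\<^sub>f = len f b\<^sub>f\<close> of
  the tree edges \<open>f\<close>. Its coefficients are sums of the flows of two tree paths, which are the signs
  of the formula (\<open>tree_sign_eq_flow\<close>).

  Two general facts make this computation sufficient. Two choices of points give homotopic
  monodromy operators, and the homotopy kills the Ceresa cycle because its coefficients are tangent
  to its edges (\<open>monodromy_homotopy\<close>, \<open>point_shift_ceresa_cycle\<close>). And two integral fillings differ
  by an integral cycle, so their monodromies agree modulo \<open>L21\<close> (\<open>ceresa_class_eqI\<close>).

  The combinatorial input is that the curve maps to well-defined cells of the Jacobian, which
  holds because all periods come from closed walks at the base point
  (\<open>cycle_is_flow_of_closed_walk\<close>), and that the primitive tangent vectors are \<open>\<plusminus> b\<^sub>e\<close>, which holds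
  because no edge separates the graph (\<open>integral_form_with_value_1\<close>).
\<close>

section \<open>Walks and their flows\<close>

definition flow :: "('e \<times> bool) list \<Rightarrow> 'e \<Rightarrow> int" where
  "flow p e = (\<Sum>s\<leftarrow>p. if fst s = e then (if snd s then 1 else - 1) else 0)"

definition rev_walk :: "('e \<times> bool) list \<Rightarrow> ('e \<times> bool) list" where
  "rev_walk p = rev (map (\<lambda>(e, d). (e, \<not> d)) p)"

lemma flow_Nil [simp]: "flow [] e = 0"
  and flow_Cons: "flow (s # p) e = (if fst s = e then (if snd s then 1 else - 1) else 0) + flow p e"
  and flow_append [simp]: "flow (p @ q) e = flow p e + flow q e"
  by (auto simp: flow_def)

lemma flow_rev_walk [simp]: "flow (rev_walk p) e = - flow p e"
  by (induction p) (auto simp: rev_walk_def flow_Cons)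

lemma flow_eq_0: "e \<notin> fst ` set p \<Longrightarrow> flow p e = 0"
  by (induction p) (auto simp: flow_Cons)

lemma is_walk_append:
  "is_walk G F u p v \<Longrightarrow> is_walk G F v q w \<Longrightarrow> is_walk G F u (p @ q) w"
  by (induction p arbitrary: u) auto

lemma is_walk_edges: "is_walk G F u p v \<Longrightarrow> fst ` set p \<subseteq> F"
  by (induction p arbitrary: u) auto

lemma flow_off_walk: "is_walk G F u p v \<Longrightarrow> e \<notin> F \<Longrightarrow> flow p e = 0"
  using is_walk_edges flow_eq_0 by (metis subsetD)

lemma is_walk_mono: "is_walk G F u p v \<Longrightarrow> fst ` set p \<subseteq> F' \<Longrightarrow> is_walk G F' u p v"
  by (induction p arbitrary: u) auto

lemma is_walk_last_in_verts: "is_walk G F u p v \<Longrightarrow> v \<in> verts G"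
  by (induction p arbitrary: u) auto

lemma is_walk_last: "is_walk G F u p v \<Longrightarrow> v = last (u # map (step_end G) p)"
  by (induction p arbitrary: u) auto

lemma is_walk_rev_walk:
  assumes "wf_digraph G" "F \<subseteq> arcs G"
  shows "is_walk G F u p v \<Longrightarrow> is_walk G F v (rev_walk p) u"
proof (induction p arbitrary: u)
  case Nil
  then show ?case by (auto simp: rev_walk_def)
next
  case (Cons s p)
  obtain e d where s: "s = (e, d)" by (cases s)
  have "is_walk G F v (rev_walk p) (step_end G s)" "e \<in> F" "step_start G s = u"
    using Cons s by auto
  moreover from this have "is_walk G F (step_end G s) [(e, \<not> d)] u"
    using assms s by (auto simp: wf_digraph_def)
  ultimately show ?case
    using s by (auto simp: rev_walk_def intro: is_walk_append)
qed

lemma connected_imp_walk: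
  assumes conn: "Digraph_Component.connected (G\<lparr>arcs := F\<rparr>)"
    and wf: "wf_digraph G" and F: "F \<subseteq> arcs G" and u: "u \<in> verts G" and v: "v \<in> verts G"
  shows "\<exists>p. is_walk G F u p v"
proof -
  have "u \<rightarrow>\<^sup>*\<^bsub>mk_symmetric (G\<lparr>arcs := F\<rparr>)\<^esub> v"
    using conn u v by (auto simp: connected_def strongly_connected_def mk_symmetric_def)
  then have "(u, v) \<in> rtrancl_on (verts G) (arcs_ends (mk_symmetric (G\<lparr>arcs := F\<rparr>)))"
    by (simp add: reachable_def mk_symmetric_def)
  then show ?thesis
  proof (induction rule: rtrancl_on_induct)
    case base
    then show ?case using u by (intro exI[of _ "[]"]) auto
  next
    case (step y z)
    then obtain p where p: "is_walk G F u p y" by auto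
    from step(2) obtain e where e: "e \<in> F"
      "(y, z) = (tail G e, head G e) \<or> (y, z) = (head G e, tail G e)"
      by (auto simp: arcs_ends_def arc_to_ends_def mk_symmetric_def)
    have "\<exists>d. is_walk G F y [(e, d)] z"
      using e(2)
    proof
      assume "(y, z) = (tail G e, head G e)"
      then show ?thesis using e(1) step(4) by (intro exI[of _ True]) simp
    next
      assume "(y, z) = (head G e, tail G e)"
      then show ?thesis using e(1) step(4) by (intro exI[of _ False]) simp
    qed
    with p show ?case by (blast intro: is_walk_append)
  qed
qed

text \<open>
  As long as a vertex repeats, the walk can be shortened by cutting out the part between two visits.
\<close>

lemma walk_imp_simple_path:
  assumes "is_walk G F u p v"
  shows "\<exists>q. is_simple_path G F u q v"
  using assms
proof (induction "length p" arbitrary: p rule: less_induct)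
  case less
  show ?case
  proof (cases "distinct (u # map (step_end G) p)")
    case True
    then show ?thesis using less.prems by (auto simp: is_simple_path_def)
  next
    case False
    have shortcut: "\<exists>q. length q < length p \<and> is_walk G F u q v"
      if "is_walk G F u p v" "\<not> distinct (u # map (step_end G) p)" for u p
      using that
    proof (induction p arbitrary: u)
      case Nil
      then show ?case by auto
    next
      case (Cons s p)
      show ?case
      proof (cases "u \<in> set (map (step_end G) (s # p))")
        case True
        then obtain ys t zs where split: "s # p = ys @ t # zs" "step_end G t = u"
          by (metis in_set_conv_decomp imageE list.set_map)
        have "is_walk G F (step_end G t) zs v" if "is_walk G F w (ys @ t # zs) v" for w
          using that by (induction ys arbitrary: w) auto
        then have "is_walk G F u zs v" using Cons.prems split by metis
        moreover have "length zs < length (s # p)" using split by auto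
        ultimately show ?thesis by blast
      next
        case False
        then have "\<not> distinct (step_end G s # map (step_end G) p)" using Cons.prems by auto
        with Cons obtain q where "length q < length p" "is_walk G F (step_end G s) q v"
          by fastforce
        then show ?thesis using Cons.prems by (intro exI[of _ "s # q"]) auto
      qed
    qed
    with less False show ?thesis by blast
  qed
qed

lemma endpoint_on_walk:
  assumes "is_walk G F u p v" "(e, d) \<in> set p"
  shows "tail G e \<in> set (u # map (step_end G) p)" "head G e \<in> set (u # map (step_end G) p)"
  using assms by (induction p arbitrary: u) (auto split: if_splits)

text \<open>
  An edge used twice would bring the path back to the starting point of its first use.
\<close>

lemma simple_path_distinct_edges:
  "is_simple_path G F u p v \<Longrightarrow> distinct (map fst p)"
proof (induction p arbitrary: u)
  case Nil
  then show ?case by simp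
next
  case (Cons s p)
  have simple: "is_simple_path G F (step_end G s) p v" and start: "step_start G s = u"
    and notin: "u \<notin> set (step_end G s # map (step_end G) p)"
    using Cons.prems by (auto simp: is_simple_path_def)
  have "fst s \<notin> fst ` set p"
  proof
    assume "fst s \<in> fst ` set p"
    then obtain d where "(fst s, d) \<in> set p" by force
    with endpoint_on_walk[of G F "step_end G s" p v "fst s" d] simple notin start show False
      by (cases s) (auto simp: is_simple_path_def split: if_splits)
  qed
  with Cons.IH[OF simple] show ?case by auto
qed

lemma flow_distinct_edges:
  assumes "distinct (map fst p)"
  shows "(e, True) \<in> set p \<longleftrightarrow> flow p e = 1" "(e, False) \<in> set p \<longleftrightarrow> flow p e = - 1"
    "e \<in> fst ` set p \<longleftrightarrow> flow p e \<noteq> 0"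
proof -
  have "((e, True) \<in> set p \<longleftrightarrow> flow p e = 1) \<and> ((e, False) \<in> set p \<longleftrightarrow> flow p e = - 1) \<and>
    (e \<in> fst ` set p \<longleftrightarrow> flow p e \<noteq> 0)"
    using assms
  proof (induction p)
    case Nil
    then show ?case by simp
  next
    case (Cons s p)
    obtain e' d where s: "s = (e', d)" by (cases s)
    show ?case
    proof (cases "e = e'")
      case True
      then have "e \<notin> fst ` set p" using Cons.prems s by auto
      moreover from this have "(e, x) \<notin> set p" for x by force
      ultimately show ?thesis using True s flow_eq_0[of e p] by (auto simp: flow_Cons)
    next
      case False
      then show ?thesis using Cons s by (auto simp: flow_Cons)
    qed
  qed
  then show "(e, True) \<in> set p \<longleftrightarrow> flow p e = 1" "(e, False) \<in> set p \<longleftrightarrow> flow p e = - 1"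
    "e \<in> fst ` set p \<longleftrightarrow> flow p e \<noteq> 0" by auto
qed

text \<open>
  The first step of a simple path from \<open>u\<close> is the only one that starts at \<open>u\<close>, so the path can be
  read off step by step from the signs of its flow. For trees, where flows are easy to compute, this
  gives the uniqueness of simple paths.
\<close>

lemma simple_path_determined_by_flow:
  assumes "is_simple_path G F u p v" "is_simple_path G F u q v" "flow p = flow q"
  shows "p = q"
  using assms
proof (induction p arbitrary: u q)
  case Nil
  then have "u = v" by (auto simp: is_simple_path_def)
  with Nil(2) show ?case
    using is_walk_last[of G F u q v] last_in_set[of "map (step_end G) q"]
    by (cases q) (auto simp: is_simple_path_def)
next
  case (Cons s p)
  note dp = simple_path_distinct_edges[OF Cons.prems(1)]
  note dq = simple_path_distinct_edges[OF Cons.prems(2)]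
  have "s \<in> set q"
  proof (cases s)
    case (Pair e d)
    have "(e, d) \<in> set (s # p)" using Pair by simp
    then show ?thesis
      using flow_distinct_edges(1,2)[OF dp, of e] flow_distinct_edges(1,2)[OF dq, of e]
        Cons.prems(3) Pair by (cases d) auto
  qed
  moreover have start: "step_start G s = u" using Cons.prems by (auto simp: is_simple_path_def)
  moreover have "t = s" if "is_walk G F w q v" "w \<notin> set (map (step_end G) q)"
    "s \<in> set q" "step_start G s = w" "q = t # q'" for w t q'
  proof (rule ccontr)
    assume "t \<noteq> s"
    with that have "s \<in> set q'" by auto
    then have "(fst s, snd s) \<in> set q'" by simp
    moreover have "is_walk G F (step_end G t) q' v" using that by auto
    ultimately have "step_start G s \<in> set (step_end G t # map (step_end G) q')"
      using endpoint_on_walk[of G F "step_end G t" q' v "fst s" "snd s"]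
      by (metis prod.collapse step_start.simps)
    with that show False by auto
  qed
  ultimately obtain q' where q: "q = s # q'"
    using Cons.prems(2) unfolding is_simple_path_def
    by (cases q) auto
  have "is_simple_path G F (step_end G s) p v" "is_simple_path G F (step_end G s) q' v"
    using Cons.prems q by (auto simp: is_simple_path_def)
  moreover have "flow p = flow q'"
    using Cons.prems(3) q by (auto simp: fun_eq_iff flow_Cons)
  ultimately show ?case using Cons.IH q by blast
qed

section \<open>Cycles and spanning trees\<close>

context fin_digraph
begin

text \<open>Summation by parts on the graph.\<close>

lemma sum_gradient:
  fixes \<gamma> :: "'b \<Rightarrow> 'c::comm_ring_1"
  shows "(\<Sum>e\<in>arcs G. \<gamma> e * (\<phi> (head G e) - \<phi> (tail G e))) =
    (\<Sum>v\<in>verts G. \<phi> v * ((\<Sum>e | e \<in> arcs G \<and> head G e = v. \<gamma> e) -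
                          (\<Sum>e | e \<in> arcs G \<and> tail G e = v. \<gamma> e)))"
proof -
  have "(\<Sum>e\<in>arcs G. \<gamma> e * \<phi> (f e)) =
      (\<Sum>v\<in>verts G. \<phi> v * (\<Sum>e | e \<in> arcs G \<and> f e = v. \<gamma> e))"
    if "f ` arcs G \<subseteq> verts G" for f
  proof -
    have "(\<Sum>v\<in>verts G. \<phi> v * (\<Sum>e | e \<in> arcs G \<and> f e = v. \<gamma> e)) =
        (\<Sum>v\<in>verts G. \<Sum>e | e \<in> arcs G \<and> f e = v. \<gamma> e * \<phi> (f e))"
      by (intro sum.cong refl) (auto simp: sum_distrib_left mult.commute intro!: sum.cong)
    also have "\<dots> = (\<Sum>e\<in>arcs G. \<gamma> e * \<phi> (f e))"
      using that by (intro sum.group) auto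
    finally show ?thesis ..
  qed
  moreover have "head G ` arcs G \<subseteq> verts G" "tail G ` arcs G \<subseteq> verts G" by auto
  ultimately show ?thesis by (simp add: right_diff_distrib sum_subtractf)
qed

text \<open>
  The indicator function of a vertex recovers the condition at that vertex. In this form, facts
  about cycles follow from a good choice of the potential \<open>\<phi>\<close>.
\<close>

lemma H1_int_iff_gradient:
  "\<gamma> \<in> H1_int G \<longleftrightarrow> (\<forall>e. e \<notin> arcs G \<longrightarrow> \<gamma> e = 0) \<and>
     (\<forall>\<phi>. (\<Sum>e\<in>arcs G. \<gamma> e * (\<phi> (head G e) - \<phi> (tail G e))) = 0)"
  (is "_ \<longleftrightarrow> ?S \<and> ?grad")
proof -
  let ?net = "\<lambda>v. (\<Sum>e | e \<in> arcs G \<and> head G e = v. \<gamma> e) - (\<Sum>e | e \<in> arcs G \<and> tail G e = v. \<gamma> e)"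
  have "(\<forall>v\<in>verts G. ?net v = 0) \<longleftrightarrow> ?grad"
  proof (intro iffI ballI allI)
    fix \<phi> assume "\<forall>v\<in>verts G. ?net v = 0"
    then show "(\<Sum>e\<in>arcs G. \<gamma> e * (\<phi> (head G e) - \<phi> (tail G e))) = 0"
      unfolding sum_gradient by (intro sum.neutral) simp
  next
    fix v assume grad: ?grad and v: "v \<in> verts G"
    have "0 = (\<Sum>w\<in>verts G. of_bool (w = v) * ?net w)"
      using grad[rule_format, of "\<lambda>w. of_bool (w = v)"]
        sum_gradient[of \<gamma> "\<lambda>w. of_bool (w = v)"] by (simp del: sum_mult_of_bool_eq)
    also have "\<dots> = (\<Sum>w\<in>verts G. if w = v then ?net w else 0)"
      by (intro sum.cong) auto
    also have "\<dots> = ?net v" using v by simp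
    finally show "?net v = 0" ..
  qed
  then show ?thesis unfolding H1_int_def by auto
qed

lemma H1_int_add: "\<gamma> \<in> H1_int G \<Longrightarrow> \<delta> \<in> H1_int G \<Longrightarrow> (\<lambda>e. \<gamma> e + \<delta> e) \<in> H1_int G"
  unfolding H1_int_iff_gradient by (auto simp: distrib_right sum.distrib)

lemma H1_int_diff: "\<gamma> \<in> H1_int G \<Longrightarrow> \<delta> \<in> H1_int G \<Longrightarrow> (\<lambda>e. \<gamma> e - \<delta> e) \<in> H1_int G"
  unfolding H1_int_iff_gradient by (auto simp: left_diff_distrib sum_subtractf)

lemma H1_int_mult: "\<gamma> \<in> H1_int G \<Longrightarrow> (\<lambda>e. n * \<gamma> e) \<in> H1_int G"
  unfolding H1_int_iff_gradient by (auto simp: mult.assoc simp flip: sum_distrib_left)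

lemma H1_int_sum:
  "(\<And>i. i \<in> I \<Longrightarrow> \<gamma> i \<in> H1_int G) \<Longrightarrow> (\<lambda>e. \<Sum>i\<in>I. \<gamma> i e) \<in> H1_int G"
proof (induction I rule: infinite_finite_induct)
  case (insert i I)
  then show ?case using H1_int_add[of "\<gamma> i" "\<lambda>e. \<Sum>i\<in>I. \<gamma> i e"] by simp
qed (auto simp: H1_int_def)

lemma harmonic_int_eq_H1_int: "harmonic_int G = H1_int G"
  by (auto simp: harmonic_int_def H1_int_def)

text \<open>The sum telescopes along the walk; in particular, closed walks give cycles.\<close>

lemma sum_flow_gradient:
  fixes \<phi> :: "'a \<Rightarrow> int"
  assumes "is_walk G (arcs G) u p v"
  shows "(\<Sum>e\<in>arcs G. flow p e * (\<phi> (head G e) - \<phi> (tail G e))) = \<phi> v - \<phi> u"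
  using assms
proof (induction p arbitrary: u)
  case Nil
  then show ?case by simp
next
  case (Cons s p)
  obtain e0 d where s: "s = (e0, d)" by (cases s)
  have e0: "e0 \<in> arcs G" "step_start G s = u" and "is_walk G (arcs G) (step_end G s) p v"
    using Cons.prems s by auto
  then have IH: "(\<Sum>e\<in>arcs G. flow p e * (\<phi> (head G e) - \<phi> (tail G e))) = \<phi> v - \<phi> (step_end G s)"
    using Cons.IH by blast
  have "(\<Sum>e\<in>arcs G. flow (s # p) e * (\<phi> (head G e) - \<phi> (tail G e))) =
    (\<Sum>e\<in>arcs G. (if e = e0 then (if d then 1 else - 1) * (\<phi> (head G e) - \<phi> (tail G e)) else 0)) +
    (\<Sum>e\<in>arcs G. flow p e * (\<phi> (head G e) - \<phi> (tail G e)))"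
    unfolding sum.distrib[symmetric] s by (intro sum.cong) (auto simp: flow_Cons algebra_simps)
  also have "\<dots> = (\<phi> (step_end G s) - \<phi> u) + (\<phi> v - \<phi> (step_end G s))"
    using e0 s IH by (auto split: if_splits)
  finally show ?case by simp
qed

lemma flow_diff_in_H1_int:
  assumes "is_walk G (arcs G) u p v" "is_walk G (arcs G) u q v"
  shows "(\<lambda>e. flow p e - flow q e) \<in> H1_int G"
  unfolding H1_int_iff_gradient
  using assms[THEN flow_off_walk] assms[THEN sum_flow_gradient]
  by (simp add: left_diff_distrib sum_subtractf)

lemma closed_walk_flow_in_H1_int:
  assumes "is_walk G (arcs G) u p u"
  shows "flow p \<in> H1_int G"
  using flow_diff_in_H1_int[OF assms, of "[]"] is_walk_last_in_verts[OF assms] by simp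

end

locale rooted_spanning_tree = fin_digraph G for G :: "('v, 'e) pre_digraph" +
  fixes F :: "'e set" and b :: 'v
  assumes spanning_tree: "is_spanning_tree G F"
    and root: "b \<in> verts G"
begin

lemma F_arcs: "F \<subseteq> arcs G"
  using spanning_tree by (simp add: is_spanning_tree_def)

lemma walk_in_arcs: "is_walk G F u p v \<Longrightarrow> is_walk G (arcs G) u p v"
  using is_walk_mono is_walk_edges F_arcs by (metis order_trans)

lemma simple_path_exists:
  assumes "u \<in> verts G" "v \<in> verts G"
  shows "\<exists>p. is_simple_path G F u p v"
proof -
  have "\<exists>p. is_walk G F u p v"
    using spanning_tree connected_imp_walk[OF _ wf_digraph_axioms F_arcs assms]
    by (simp add: is_spanning_tree_def)
  then show ?thesis using walk_imp_simple_path by metis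
qed

text \<open>
  Deleting \<open>e\<close> from the tree separates its ends. The indicator function of the part that contains
  the head of \<open>e\<close> is a potential whose gradient on the tree is concentrated on \<open>e\<close>. All that is
  needed about trees follows by summing this potential against flows.
\<close>

definition far_side :: "'e \<Rightarrow> 'v \<Rightarrow> int" where
  "far_side e v = of_bool (\<exists>p. is_walk G (F - {e}) v p (head G e))"

lemma far_side_cases: "far_side e v = 0 \<or> far_side e v = 1"
  unfolding far_side_def of_bool_def by simp

lemma far_side_head: "e \<in> F \<Longrightarrow> far_side e (head G e) = 1"
  using F_arcs by (auto simp: far_side_def intro!: exI[of _ "[]"])

text \<open>
  Otherwise \<open>e\<close> and a simple path from its head to its tail that avoids \<open>e\<close> would form a cycle.
\<close>

lemma far_side_tail:
  assumes "e \<in> F"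
  shows "far_side e (tail G e) = 0"
proof (rule ccontr)
  assume "far_side e (tail G e) \<noteq> 0"
  then obtain p0 where "is_walk G (F - {e}) (tail G e) p0 (head G e)"
    by (auto simp: far_side_def split: if_splits)
  then have "is_walk G (F - {e}) (head G e) (rev_walk p0) (tail G e)"
    using F_arcs by (intro is_walk_rev_walk wf_digraph_axioms) auto
  then obtain p where p: "is_simple_path G (F - {e}) (head G e) p (tail G e)"
    using walk_imp_simple_path by metis
  then have walk: "is_walk G (F - {e}) (head G e) p (tail G e)" by (simp add: is_simple_path_def)
  have "is_walk G F (head G e) p (tail G e)"
    using is_walk_mono[OF walk] is_walk_edges[OF walk] by blast
  then have "is_walk G F (tail G e) ((e, True) # p) (tail G e)"
    using assms by simp
  moreover have "distinct (map fst ((e, True) # p))"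
    using simple_path_distinct_edges[OF p] is_walk_edges[OF walk] by auto
  moreover have "distinct (map (step_end G) ((e, True) # p))"
    using p by (simp add: is_simple_path_def)
  ultimately have "is_cycle G F ((e, True) # p)" by (auto simp: is_cycle_def)
  then show False using spanning_tree by (auto simp: is_spanning_tree_def)
qed

lemma far_side_const:
  assumes "e' \<in> F" "e' \<noteq> e"
  shows "far_side e (head G e') = far_side e (tail G e')"
proof -
  have "is_walk G (F - {e}) (head G e') ((e', False) # p) v" if "is_walk G (F - {e}) (tail G e') p v" for p v
    using that assms by simp
  moreover have "is_walk G (F - {e}) (tail G e') ((e', True) # p) v" if "is_walk G (F - {e}) (head G e') p v" for p v
    using that assms by simp
  ultimately have "(\<exists>p. is_walk G (F - {e}) (head G e') p (head G e)) \<longleftrightarrow>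
      (\<exists>p. is_walk G (F - {e}) (tail G e') p (head G e))"
    by blast
  then show ?thesis by (simp only: far_side_def)
qed

lemma sum_gradient_far_side:
  assumes "e \<in> F" "\<And>e'. e' \<in> arcs G - F \<Longrightarrow> \<gamma> e' = 0"
  shows "(\<Sum>e'\<in>arcs G. \<gamma> e' * (far_side e (head G e') - far_side e (tail G e'))) = \<gamma> e"
proof -
  have "(\<Sum>e'\<in>arcs G. \<gamma> e' * (far_side e (head G e') - far_side e (tail G e'))) =
      (\<Sum>e'\<in>arcs G. if e' = e then \<gamma> e' else 0)"
  proof (intro sum.cong refl)
    fix e' assume "e' \<in> arcs G"
    then show "\<gamma> e' * (far_side e (head G e') - far_side e (tail G e')) = (if e' = e then \<gamma> e' else 0)"
      using assms far_side_const[of e' e] far_side_head[of e] far_side_tail[of e]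
      by (cases "e' \<in> F") auto
  qed
  also have "\<dots> = \<gamma> e" using assms(1) F_arcs by auto
  finally show ?thesis .
qed

text \<open>
  Against the potential \<^const>\<open>far_side\<close> of \<open>e\<close>, a chain on the tree sums to its value at \<open>e\<close>, and
  a cycle sums to \<open>0\<close>.
\<close>

lemma cycle_in_tree_eq_0:
  assumes "\<gamma> \<in> H1_int G" "\<And>e. e \<in> arcs G - F \<Longrightarrow> \<gamma> e = 0"
  shows "\<gamma> = (\<lambda>_. 0)"
proof
  fix e
  show "\<gamma> e = 0"
    using assms sum_gradient_far_side[of e \<gamma>] unfolding H1_int_iff_gradient by (cases "e \<in> F") auto
qed

lemma tree_walk_flow:
  assumes "is_walk G F u p v" "e \<in> F"
  shows "flow p e = far_side e v - far_side e u"
  using sum_gradient_far_side[of e "flow p", OF assms(2)] flow_off_walk[OF assms(1)]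
    sum_flow_gradient[OF walk_in_arcs[OF assms(1)], of "far_side e"]
  by simp

lemma tree_walk_flow_eq:
  assumes "is_walk G F u p v" "is_walk G F u q v"
  shows "flow p = flow q"
proof
  fix e
  show "flow p e = flow q e"
    using assms[THEN tree_walk_flow] assms[THEN flow_off_walk] by (cases "e \<in> F") auto
qed

lemma tree_path_simple:
  assumes "u \<in> verts G" "v \<in> verts G"
  shows "is_simple_path G F u (tree_path G F u v) v"
proof -
  have "\<exists>!p. is_simple_path G F u p v"
    using simple_path_exists[OF assms] tree_walk_flow_eq simple_path_determined_by_flow
    by (metis is_simple_path_def)
  then show ?thesis unfolding tree_path_def by (rule theI')
qed

lemma tree_path_walk:
  "u \<in> verts G \<Longrightarrow> v \<in> verts G \<Longrightarrow> is_walk G F u (tree_path G F u v) v"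
  using tree_path_simple by (simp add: is_simple_path_def)

lemma on_tree_path_iff_far_side:
  assumes "u \<in> verts G" "v \<in> verts G" "e \<in> F"
  shows "on_tree_path G F u e v \<longleftrightarrow> far_side e u \<noteq> far_side e v"
  using flow_distinct_edges(3)[OF simple_path_distinct_edges[OF tree_path_simple[OF assms(1,2)]], of e]
    tree_walk_flow[OF tree_path_walk[OF assms(1,2)] assms(3)]
  by (auto simp: on_tree_path_def)

text \<open>
  All tree paths from the root that use \<open>e\<close> traverse it in the same direction, the one that
  \<^const>\<open>oriented_away\<close> records; hence the sign in the formula is a sum of two flows.
\<close>

lemma tree_sign_eq_flow:
  assumes "e \<in> F" "\<epsilon> \<in> arcs G"
  shows "tree_sign G F b e \<epsilon> = of_int (flow (tree_path G F b (tail G \<epsilon>)) e) +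
                               of_int (flow (tree_path G F b (head G \<epsilon>)) e)"
proof -
  have V: "tail G \<epsilon> \<in> verts G" "head G \<epsilon> \<in> verts G" "tail G e \<in> verts G"
    using assms F_arcs by auto
  have away: "oriented_away G F b e \<longleftrightarrow> far_side e b = 0"
    using on_tree_path_iff_far_side[OF root V(3) assms(1)] far_side_tail[OF assms(1)]
    by (simp add: oriented_away_def)
  have flow: "flow (tree_path G F b v) e = far_side e v - far_side e b" if "v \<in> verts G" for v
    using tree_walk_flow[OF tree_path_walk[OF root that] assms(1)] .
  show ?thesis
    unfolding tree_sign_def away flow[OF V(1)] flow[OF V(2)]
      on_tree_path_iff_far_side[OF root V(1) assms(1)] on_tree_path_iff_far_side[OF root V(2) assms(1)]
    using far_side_cases[of e "tail G \<epsilon>"] far_side_cases[of e "head G \<epsilon>"] far_side_cases[of e b]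
    by (elim disjE) simp_all
qed

text \<open>The loop at the root that follows the tree to the tail of \<open>\<epsilon>\<close>, crosses \<open>\<epsilon>\<close> and returns.\<close>

definition root_loop :: "'e \<Rightarrow> ('e \<times> bool) list" where
  "root_loop \<epsilon> = tree_path G F b (tail G \<epsilon>) @ (\<epsilon>, True) # rev_walk (tree_path G F b (head G \<epsilon>))"

lemma root_loop_closed:
  assumes "\<epsilon> \<in> arcs G"
  shows "is_walk G (arcs G) b (root_loop \<epsilon>) b"
proof -
  have "is_walk G (arcs G) b (tree_path G F b v) v" if "v \<in> verts G" for v
    using walk_in_arcs tree_path_walk[OF root that] .
  then have "is_walk G (arcs G) b (tree_path G F b (tail G \<epsilon>)) (tail G \<epsilon>)"
    "is_walk G (arcs G) (head G \<epsilon>) (rev_walk (tree_path G F b (head G \<epsilon>))) b"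
    using assms by (auto intro: is_walk_rev_walk wf_digraph_axioms)
  then show ?thesis unfolding root_loop_def using assms by (intro is_walk_append) auto
qed

lemma root_loop_flow_off_tree:
  assumes "\<epsilon> \<in> arcs G" "e \<in> arcs G - F"
  shows "flow (root_loop \<epsilon>) e = of_bool (e = \<epsilon>)"
  using assms tree_path_walk[OF root, THEN flow_off_walk, of _ e]
  by (auto simp: root_loop_def flow_Cons)

text \<open>
  Both sides agree off the tree, where only \<open>root_loop \<epsilon>\<close> meets \<open>\<epsilon>\<close>, and a cycle is determined by
  its values there.
\<close>

lemma cycle_eq_sum_root_loops:
  assumes "\<gamma> \<in> H1_int G"
  shows "\<gamma> = (\<lambda>e. \<Sum>\<epsilon>\<in>arcs G - F. \<gamma> \<epsilon> * flow (root_loop \<epsilon>) e)"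
proof -
  let ?\<delta> = "\<lambda>e. \<gamma> e - (\<Sum>\<epsilon>\<in>arcs G - F. \<gamma> \<epsilon> * flow (root_loop \<epsilon>) e)"
  have "?\<delta> \<in> H1_int G"
    using assms closed_walk_flow_in_H1_int[OF root_loop_closed]
    by (intro H1_int_diff H1_int_sum H1_int_mult) auto
  moreover have "?\<delta> e = 0" if e: "e \<in> arcs G - F" for e
  proof -
    have "(\<Sum>\<epsilon>\<in>arcs G - F. \<gamma> \<epsilon> * flow (root_loop \<epsilon>) e) = (\<Sum>\<epsilon>\<in>arcs G - F. if \<epsilon> = e then \<gamma> \<epsilon> else 0)"
      using e by (intro sum.cong) (auto simp: root_loop_flow_off_tree)
    then show ?thesis using e by simp
  qed
  ultimately have "?\<delta> = (\<lambda>_. 0)" by (rule cycle_in_tree_eq_0)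
  from fun_cong[OF this] show ?thesis by (intro ext) (rule iffD2[OF eq_iff_diff_eq_0])
qed

text \<open>
  The flows of closed walks at the root form a group, and the loops above generate all cycles.
\<close>

lemma cycle_is_flow_of_closed_walk:
  assumes "\<gamma> \<in> H1_int G"
  shows "\<exists>p. is_walk G (arcs G) b p b \<and> flow p = \<gamma>"
proof -
  let ?S = "{flow p | p. is_walk G (arcs G) b p b}"
  have zero: "(\<lambda>_. 0) \<in> ?S"
    using root by (intro CollectI exI[of _ "[]"]) auto
  have add: "(\<lambda>e. f e + g e) \<in> ?S" if f: "f \<in> ?S" and g: "g \<in> ?S" for f g
  proof -
    obtain p q where "is_walk G (arcs G) b p b" "f = flow p" "is_walk G (arcs G) b q b" "g = flow q"
      using f g by auto
    then show ?thesis
      by (intro CollectI exI[of _ "p @ q"]) (auto intro: is_walk_append)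
  qed
  have uminus: "(\<lambda>e. - f e) \<in> ?S" if f: "f \<in> ?S" for f
  proof -
    obtain p where "is_walk G (arcs G) b p b" "f = flow p"
      using f by auto
    then show ?thesis
      by (intro CollectI exI[of _ "rev_walk p"]) (auto intro: is_walk_rev_walk wf_digraph_axioms)
  qed
  have nmult: "(\<lambda>e. int n * f e) \<in> ?S" if f: "f \<in> ?S" for f n
    by (induction n) (use zero add[OF f] in \<open>auto simp: distrib_right\<close>)
  have mult: "(\<lambda>e. k * f e) \<in> ?S" if f: "f \<in> ?S" for f k
    using nmult[OF f, of "nat k"] uminus[OF nmult[OF f, of "nat (- k)"]] by (cases "0 \<le> k") auto
  have "(\<lambda>e. \<Sum>\<epsilon>\<in>B. \<gamma> \<epsilon> * flow (root_loop \<epsilon>) e) \<in> ?S" if "finite B" "B \<subseteq> arcs G" for B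
    using that
  proof (induction B)
    case empty
    then show ?case using zero by simp
  next
    case (insert \<epsilon> B)
    have "flow (root_loop \<epsilon>) \<in> ?S" using root_loop_closed insert by auto
    from mult[OF this, of "\<gamma> \<epsilon>"] insert show ?case
      using add[of "\<lambda>e. \<gamma> \<epsilon> * flow (root_loop \<epsilon>) e" "\<lambda>e. \<Sum>\<epsilon>\<in>B. \<gamma> \<epsilon> * flow (root_loop \<epsilon>) e"]
      by simp
  qed
  from this[of "arcs G - F"] show ?thesis
    using cycle_eq_sum_root_loops[OF assms] by auto
qed

end


section \<open>Functionals on harmonic forms and the period lattice\<close>

lemma scaleR_fun_apply [simp]: "(c *\<^sub>R f) x = c *\<^sub>R f x"
  by (simp add: scaleR_fun_def)

lemma sum_fun_apply: "(\<Sum>i\<in>I. f i) x = (\<Sum>i\<in>I. f i x)"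
  by (induction I rule: infinite_finite_induct) auto

text \<open>
  This says that \<open>A\<close> is an additive subgroup. Chains with integral and with real coefficients are
  treated alike through this predicate.
\<close>

definition diff_closed :: "'c::ab_group_add set \<Rightarrow> bool" where
  "diff_closed A \<longleftrightarrow> 0 \<in> A \<and> (\<forall>x\<in>A. \<forall>y\<in>A. x - y \<in> A)"

lemma diff_closed_zero: "diff_closed A \<Longrightarrow> 0 \<in> A"
  and diff_closed_diff: "diff_closed A \<Longrightarrow> x \<in> A \<Longrightarrow> y \<in> A \<Longrightarrow> x - y \<in> A"
  by (auto simp: diff_closed_def)

lemma diff_closed_uminus: "diff_closed A \<Longrightarrow> x \<in> A \<Longrightarrow> - x \<in> A"
  using diff_closed_diff[of A 0 x] diff_closed_zero[of A] by simp

lemma diff_closed_add: "diff_closed A \<Longrightarrow> x \<in> A \<Longrightarrow> y \<in> A \<Longrightarrow> x + y \<in> A"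
  using diff_closed_diff[of A x "- y"] diff_closed_uminus[of A y] by simp

lemma diff_closed_sum:
  "diff_closed A \<Longrightarrow> (\<And>i. i \<in> I \<Longrightarrow> f i \<in> A) \<Longrightarrow> (\<Sum>i\<in>I. f i) \<in> A"
  by (induction I rule: infinite_finite_induct) (auto intro: diff_closed_add diff_closed_zero)

lemma diff_closed_sign:
  fixes x :: "'c::real_vector"
  assumes "diff_closed A" "x \<in> A"
  shows "(- 1) ^ i *\<^sub>R x \<in> A"
  using assms by (cases "even i") (auto intro: diff_closed_uminus)

lemma subspace_diff_closed: "subspace A \<Longrightarrow> diff_closed A"
  by (simp add: diff_closed_def subspace_0 subspace_diff)

lemma Omega_dual_subspace: "subspace (Omega_dual G)"
  unfolding subspace_def Omega_dual_def by (auto simp: algebra_simps)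

lemma Omega_dual_diff_closed: "diff_closed (Omega_dual G)"
  by (rule subspace_diff_closed[OF Omega_dual_subspace])

lemma Omega_dual_int_diff_closed: "diff_closed (Omega_dual_int G)"
  using Omega_dual_diff_closed[of G] unfolding Omega_dual_int_def diff_closed_def by auto

lemma Omega_dual_int_subset: "Omega_dual_int G \<subseteq> Omega_dual G"
  by (auto simp: Omega_dual_int_def)

lemma Omega_int_in_Omega: "\<omega> \<in> Omega_int G \<Longrightarrow> \<omega> \<in> Omega G"
  unfolding Omega_def by (rule span_base)

lemma b_edge_apply: "\<omega> \<in> Omega G \<Longrightarrow> b_edge G e \<omega> = \<omega> e"
  by (simp add: b_edge_def)

lemma b_edge_integral: "b_edge G e \<in> Omega_dual_int G"
proof -
  have "subspace (Omega G)" unfolding Omega_def by (rule subspace_span)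
  then have "b_edge G e \<in> Omega_dual G"
    by (auto simp: Omega_dual_def b_edge_def subspace_add subspace_scale)
  moreover have "b_edge G e \<omega> \<in> \<int>" if "\<omega> \<in> Omega_int G" for \<omega>
    using that Omega_int_in_Omega[OF that] by (auto simp: b_edge_apply Omega_int_def)
  ultimately show ?thesis by (simp add: Omega_dual_int_def)
qed

lemma b_edge_in_dual: "b_edge G e \<in> Omega_dual G"
  by (rule subsetD[OF Omega_dual_int_subset b_edge_integral])

context fin_digraph
begin

text \<open>
  This is the harmonicity of the forms, read as a relation between functionals. The condition is
  linear, so it passes from integral forms to their span.
\<close>

lemma sum_b_edge_at_vertex:
  assumes "v \<in> verts G"
  shows "(\<Sum>e | e \<in> arcs G \<and> head G e = v. b_edge G e) = (\<Sum>e | e \<in> arcs G \<and> tail G e = v. b_edge G e)"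
proof
  fix \<omega>
  let ?W = "{\<omega>::'b \<Rightarrow> real. (\<Sum>e | e \<in> arcs G \<and> head G e = v. \<omega> e) = (\<Sum>e | e \<in> arcs G \<and> tail G e = v. \<omega> e)}"
  have "Omega_int G \<subseteq> ?W"
    using assms by (auto simp: Omega_int_def harmonic_int_def simp flip: of_int_sum)
  moreover have "subspace ?W"
    by (auto simp: subspace_def sum.distrib simp flip: sum_distrib_left)
  ultimately have "Omega G \<subseteq> ?W"
    unfolding Omega_def by (rule span_minimal)
  then show "(\<Sum>e | e \<in> arcs G \<and> head G e = v. b_edge G e) \<omega> = (\<Sum>e | e \<in> arcs G \<and> tail G e = v. b_edge G e) \<omega>"
    by (cases "\<omega> \<in> Omega G") (auto simp: sum_fun_apply b_edge_def)
qed

end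

context tropical_curve
begin

lemma I_edge_in_dual: "I_edge e \<in> Omega_dual G"
  unfolding I_edge_def by (rule subspace_scale[OF Omega_dual_subspace b_edge_in_dual])

lemma I_chain_in_dual: "I_chain \<gamma> \<in> Omega_dual G"
  unfolding I_chain_def
  by (intro subspace_sum subspace_scale Omega_dual_subspace I_edge_in_dual)

lemma I_chain_zero: "I_chain (\<lambda>_. 0) = 0"
  and I_chain_diff: "I_chain (\<lambda>e. \<gamma> e - \<delta> e) = I_chain \<gamma> - I_chain \<delta>"
  by (simp_all add: I_chain_def scaleR_left_diff_distrib sum_subtractf)

lemma I_walk_Nil: "I_walk [] = 0"
  and I_walk_Cons: "I_walk (s # p) = (if snd s then I_edge (fst s) else - I_edge (fst s)) + I_walk p"
  and I_walk_append: "I_walk (p @ q) = I_walk p + I_walk q"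
  by (simp_all add: I_walk_def case_prod_beta)

lemma I_walk_eq_I_chain:
  assumes "fst ` set p \<subseteq> arcs G"
  shows "I_walk p = I_chain (flow p)"
  using assms
proof (induction p)
  case Nil
  then show ?case by (simp add: I_walk_Nil I_chain_def)
next
  case (Cons s p)
  have "I_chain (flow (s # p)) = (\<Sum>e\<in>arcs G. if e = fst s then (if snd s then I_edge e else - I_edge e) else 0) + I_chain (flow p)"
    unfolding I_chain_def sum.distrib[symmetric]
    by (intro sum.cong) (auto simp: flow_Cons scaleR_add_left)
  also have "\<dots> = I_walk (s # p)" using Cons by (simp add: I_walk_Cons)
  finally show ?case ..
qed

lemma I_walk_walk:
  "is_walk G F u p v \<Longrightarrow> F \<subseteq> arcs G \<Longrightarrow> I_walk p = I_chain (flow p)"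
  using is_walk_edges by (intro I_walk_eq_I_chain) fast

lemma I_walk_in_dual: "is_walk G (arcs G) u p v \<Longrightarrow> I_walk p \<in> Omega_dual G"
  by (simp add: I_walk_walk I_chain_in_dual)

lemma period_lattice_diff_closed: "diff_closed period_lattice"
proof -
  have "(\<lambda>_. 0) \<in> H1_int G" by (simp add: H1_int_def)
  then show ?thesis
    using I_chain_zero H1_int_diff
    unfolding diff_closed_def period_lattice_def
    by (auto simp: image_iff simp flip: I_chain_diff)
qed

lemma period_lattice_subset: "period_lattice \<subseteq> Omega_dual G"
  using I_chain_in_dual by (auto simp: period_lattice_def)

lemma closed_walk_period: "is_walk G (arcs G) u p u \<Longrightarrow> I_walk p \<in> period_lattice"
  unfolding period_lattice_def by (auto simp: I_walk_walk intro!: closed_walk_flow_in_H1_int)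

text \<open>
  Because \<open>e\<close> does not separate the graph, it lies on a closed walk that crosses it exactly once.
\<close>

lemma integral_form_with_value_1:
  assumes "e \<in> arcs G"
  shows "\<exists>\<omega>\<in>Omega_int G. \<omega> e = 1"
proof -
  have "Digraph_Component.connected (G\<lparr>arcs := arcs G - {e}\<rparr>)"
    using no_separating_edge[OF assms] by (cases G) (simp add: pre_digraph.del_arc_def)
  from connected_imp_walk[OF this wf_digraph_axioms, of "head G e" "tail G e"]
  obtain p where p: "is_walk G (arcs G - {e}) (head G e) p (tail G e)"
    using assms by auto
  have "is_walk G (arcs G) (head G e) p (tail G e)"
    using is_walk_mono[OF p] is_walk_edges[OF p] by blast
  then have "is_walk G (arcs G) (tail G e) ((e, True) # p) (tail G e)"
    using assms by simp
  then have "flow ((e, True) # p) \<in> harmonic_int G"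
    unfolding harmonic_int_eq_H1_int by (rule closed_walk_flow_in_H1_int)
  moreover have "flow ((e, True) # p) e = 1"
    using flow_off_walk[OF p] by (simp add: flow_Cons)
  ultimately show ?thesis unfolding Omega_int_def by force
qed

text \<open>
  An integral form with value \<open>1\<close> on \<open>e\<close> shows that \<open>b_edge G e\<close> is not a proper multiple of an
  integral functional. Evaluated on it, any other primitive vector in the same direction is seen to
  be an integral multiple of \<open>b_edge G e\<close>.
\<close>

lemma primitive_tangent_eqI:
  assumes e: "e \<in> arcs G" and \<sigma>: "\<sigma> = 1 \<or> \<sigma> = - 1" and dir: "direction P = \<sigma> *\<^sub>R I_edge e"
  shows "primitive_tangent P = \<sigma> *\<^sub>R b_edge G e"
  unfolding primitive_tangent_def
proof (rule the_equality)
  obtain \<omega> where \<omega>: "\<omega> \<in> Omega_int G" "\<omega> e = 1"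
    using integral_form_with_value_1[OF e] by blast
  then have b1: "b_edge G e \<omega> = 1" by (simp add: b_edge_apply Omega_int_in_Omega)
  have int: "w \<omega> \<in> \<int>" if "w \<in> Omega_dual_int G" for w
    using that \<omega> by (auto simp: Omega_dual_int_def)
  show "is_primitive (\<sigma> *\<^sub>R b_edge G e) \<and> (\<exists>c>0. direction P = c *\<^sub>R \<sigma> *\<^sub>R b_edge G e)"
  proof
    have mem: "\<sigma> *\<^sub>R b_edge G e \<in> Omega_dual_int G"
      using \<sigma> b_edge_integral[of G e] diff_closed_uminus[OF Omega_dual_int_diff_closed] by auto
    have val: "(\<sigma> *\<^sub>R b_edge G e) \<omega> = \<sigma>" using b1 by simp
    have ne: "\<sigma> *\<^sub>R b_edge G e \<noteq> 0"
    proof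
      assume "\<sigma> *\<^sub>R b_edge G e = 0"
      with val \<sigma> show False by (metis zero_fun_apply neg_equal_0_iff_equal zero_neq_one)
    qed
    have prim: "\<bar>k\<bar> = 1" if w: "w \<in> Omega_dual_int G" and eq: "\<sigma> *\<^sub>R b_edge G e = of_int k *\<^sub>R w" for w and k :: int
    proof -
      from int[OF w] obtain m where m: "w \<omega> = of_int m" by (auto elim: Ints_cases)
      have "\<sigma> = of_int k * of_int m" using fun_cong[OF eq, of \<omega>] val m by simp
      then have "real_of_int (k * m) = \<sigma>" by simp
      with \<sigma> have "k * m = 1 \<or> k * m = - 1"
        by (metis of_int_1 of_int_eq_iff of_int_minus)
      then show ?thesis by (metis abs_mult_self_eq abs_zmult_eq_1 abs_minus abs_1)
    qed
    show "is_primitive (\<sigma> *\<^sub>R b_edge G e)"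
      unfolding is_primitive_def using mem ne prim by blast
    show "\<exists>c>0. direction P = c *\<^sub>R \<sigma> *\<^sub>R b_edge G e"
      using dir len_pos[OF e] by (intro exI[of _ "len e"]) (simp add: I_edge_def mult.commute)
  qed
  fix v assume v: "is_primitive v \<and> (\<exists>c>0. direction P = c *\<^sub>R v)"
  then obtain c where c: "c > 0" "\<sigma> *\<^sub>R len e *\<^sub>R b_edge G e = c *\<^sub>R v"
    using dir by (auto simp: I_edge_def)
  define r where "r = \<sigma> * len e / c"
  have "v = (1 / c) *\<^sub>R c *\<^sub>R v" using c by simp
  also have "\<dots> = r *\<^sub>R b_edge G e" unfolding c(2)[symmetric] by (simp add: r_def)
  finally have v_eq: "v = r *\<^sub>R b_edge G e" .
  then have "r \<in> \<int>" using int[of v] v b1 by (auto simp: is_primitive_def)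
  then obtain k where k: "r = of_int k" by (auto elim: Ints_cases)
  have "\<forall>w\<in>Omega_dual_int G. \<forall>k::int. v = of_int k *\<^sub>R w \<longrightarrow> \<bar>k\<bar> = 1"
    using v by (simp add: is_primitive_def)
  from bspec[OF this b_edge_integral, of e] have "\<bar>k\<bar> = 1"
    using v_eq unfolding k by simp
  then have "\<bar>r\<bar> = 1" using k by auto
  moreover have "r * \<sigma> > 0"
    using \<sigma> c len_pos[OF e] by (auto simp: r_def)
  ultimately have "r = \<sigma>" using \<sigma> by auto
  then show "v = \<sigma> *\<^sub>R b_edge G e" using v_eq by simp
qed

lemma jac_cell_eqI:
  assumes "h \<in> period_lattice" "ys = map (\<lambda>x. h + x) xs"
  shows "jac_cell ys = jac_cell xs"
proof -
  note closed = period_lattice_diff_closed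
  have "(\<lambda>x. k + x) \<circ> (\<lambda>x. h + x) = (\<lambda>x. (k + h) + x)" for k
    by (auto simp: fun_eq_iff add.assoc)
  then have shift: "map (\<lambda>x. k + x) ys = map (\<lambda>x. (k + h) + x) xs" for k
    using assms(2) by simp
  have "jac_cell ys \<subseteq> jac_cell xs"
    unfolding jac_cell_def shift using diff_closed_add[OF closed _ assms(1)] by blast
  moreover have "jac_cell xs \<subseteq> jac_cell ys"
  proof
    fix l assume "l \<in> jac_cell xs"
    then obtain k where k: "k \<in> period_lattice" "l = map (\<lambda>x. k + x) xs"
      by (auto simp: jac_cell_def)
    then have "l = map (\<lambda>x. (k - h) + x) ys" unfolding shift by simp
    then show "l \<in> jac_cell ys"
      unfolding jac_cell_def using diff_closed_diff[OF closed k(1) assms(1)] by blast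
  qed
  ultimately show ?thesis ..
qed

lemma in_jac_cell: "xs \<in> jac_cell xs"
  unfolding jac_cell_def using diff_closed_zero[OF period_lattice_diff_closed]
  by (intro CollectI exI[of _ 0]) (simp add: map_idI)

lemma direction_jac_cell: "direction (jac_cell [x, y]) = y - x"
  unfolding direction_def
proof (rule the_equality)
  show "\<exists>x' y'. [x', y'] \<in> jac_cell [x, y] \<and> y - x = y' - x'"
    using in_jac_cell by blast
qed (auto simp: jac_cell_def)

end

section \<open>The curve in the universal cover\<close>

locale tropical_curve_with_tree = tropical_curve G len + rooted_spanning_tree G F b
  for G :: "('v, 'e) pre_digraph" and len F b
begin

text \<open>The lift of the vertex \<open>v\<close> to the universal cover along the tree.\<close>

definition pos :: "'v \<Rightarrow> 'e covec" where
  "pos v = I_walk (tree_path G F b v)"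

lemma pos_eq_I_walk:
  assumes "is_walk G F b p v"
  shows "pos v = I_walk p"
proof -
  have v: "v \<in> verts G" using is_walk_last_in_verts[OF assms] .
  show ?thesis
    unfolding pos_def I_walk_walk[OF tree_path_walk[OF root v] F_arcs] I_walk_walk[OF assms F_arcs]
    by (rule arg_cong[of _ _ I_chain]) (rule tree_walk_flow_eq[OF tree_path_walk[OF root v] assms])
qed

lemma pos_in_dual: "v \<in> verts G \<Longrightarrow> pos v \<in> Omega_dual G"
  unfolding pos_def using I_walk_in_dual walk_in_arcs tree_path_walk[OF root] by blast

lemma pos_eq_sum_tree:
  assumes "v \<in> verts G"
  shows "pos v = (\<Sum>e\<in>F. (of_int (flow (tree_path G F b v) e) * len e) *\<^sub>R b_edge G e)"
proof -
  note p = tree_path_walk[OF root assms]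
  have "pos v = (\<Sum>e\<in>arcs G. (of_int (flow (tree_path G F b v) e) * len e) *\<^sub>R b_edge G e)"
    unfolding pos_def I_walk_walk[OF p F_arcs] by (simp add: I_chain_def I_edge_def)
  also have "\<dots> = (\<Sum>e\<in>F. (of_int (flow (tree_path G F b v) e) * len e) *\<^sub>R b_edge G e)"
    using F_arcs flow_off_walk[OF p] by (intro sum.mono_neutral_right) auto
  finally show ?thesis .
qed

text \<open>The period by which the lift of \<open>e\<close> that starts at \<open>pos (tail G e)\<close> misses \<open>pos (head G e)\<close>.\<close>

definition gap :: "'e \<Rightarrow> 'e covec" where
  "gap e = pos (tail G e) + I_edge e - pos (head G e)"

lemma gap_tree: "e \<in> F \<Longrightarrow> gap e = 0"
proof -
  assume e: "e \<in> F"
  then have V: "tail G e \<in> verts G" "head G e \<in> verts G" using F_arcs by auto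
  have "is_walk G F b (tree_path G F b (tail G e) @ [(e, True)]) (head G e)"
    using e V by (intro is_walk_append[OF tree_path_walk[OF root V(1)]]) simp
  from pos_eq_I_walk[OF this] show ?thesis
    by (simp add: gap_def pos_def I_walk_append I_walk_Cons I_walk_Nil)
qed

lemma a_cycle_eq_gap:
  assumes "\<epsilon> \<in> arcs G"
  shows "a_cycle F \<epsilon> = gap \<epsilon>"
proof -
  have V: "tail G \<epsilon> \<in> verts G" "head G \<epsilon> \<in> verts G" using assms by auto
  have "is_walk G F b (tree_path G F b (head G \<epsilon>) @ tree_path G F (head G \<epsilon>) (tail G \<epsilon>)) (tail G \<epsilon>)"
    using V root by (intro is_walk_append[OF tree_path_walk tree_path_walk])
  from pos_eq_I_walk[OF this]
  have "pos (tail G \<epsilon>) = pos (head G \<epsilon>) + I_walk (tree_path G F (head G \<epsilon>) (tail G \<epsilon>))"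
    by (simp add: I_walk_append pos_def)
  then show ?thesis by (simp add: a_cycle_def gap_def I_walk_Cons)
qed

lemma gap_period:
  assumes "\<epsilon> \<in> arcs G"
  shows "gap \<epsilon> \<in> period_lattice"
proof -
  have V: "tail G \<epsilon> \<in> verts G" "head G \<epsilon> \<in> verts G" using assms by auto
  have "is_walk G (arcs G) (tail G \<epsilon>) ((\<epsilon>, True) # tree_path G F (head G \<epsilon>) (tail G \<epsilon>)) (tail G \<epsilon>)"
    using assms walk_in_arcs[OF tree_path_walk[OF V(2,1)]] by simp
  from closed_walk_period[OF this] show ?thesis
    by (simp add: a_cycle_eq_gap[OF assms, symmetric] a_cycle_def)
qed

text \<open>
  Any two walks to the tail of \<open>e\<close> differ by a closed walk, and every period comes from a closed
  walk at the root; so the lifts collected in \<^const>\<open>curve_edge\<close> are all the lifts of one cell.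
\<close>

lemma curve_edge_eq_jac_cell:
  assumes e: "e \<in> arcs G" and \<sigma>: "\<sigma> = 1 \<or> \<sigma> = - 1"
  shows "curve_edge \<sigma> b e = jac_cell [\<sigma> *\<^sub>R pos (tail G e), \<sigma> *\<^sub>R (pos (tail G e) + I_edge e)]"
    (is "?L = ?R")
proof
  define p0 where "p0 = tree_path G F b (tail G e)"
  have p0: "is_walk G (arcs G) b p0 (tail G e)"
    unfolding p0_def using e by (intro walk_in_arcs tree_path_walk root) auto
  have pos: "pos (tail G e) = I_walk p0" by (simp add: pos_def p0_def)
  have sign: "\<sigma> *\<^sub>R h \<in> period_lattice" if "h \<in> period_lattice" for h
    using \<sigma> that diff_closed_uminus[OF period_lattice_diff_closed] by auto
  show "?L \<subseteq> ?R"
  proof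
    fix l assume "l \<in> ?L"
    then obtain p where p: "is_walk G (arcs G) b p (tail G e)"
      and l: "l = [\<sigma> *\<^sub>R I_walk p, \<sigma> *\<^sub>R (I_walk p + I_edge e)]"
      by (auto simp: curve_edge_def)
    have "I_walk p - I_walk p0 \<in> period_lattice"
      unfolding period_lattice_def I_walk_walk[OF p subset_refl] I_walk_walk[OF p0 subset_refl]
        I_chain_diff[symmetric]
      by (intro imageI flow_diff_in_H1_int[OF p p0])
    then have "\<sigma> *\<^sub>R (I_walk p - I_walk p0) \<in> period_lattice" by (rule sign)
    moreover have "l = map (\<lambda>x. \<sigma> *\<^sub>R (I_walk p - I_walk p0) + x)
        [\<sigma> *\<^sub>R pos (tail G e), \<sigma> *\<^sub>R (pos (tail G e) + I_edge e)]"
      unfolding l pos by (simp add: algebra_simps)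
    ultimately show "l \<in> ?R" unfolding jac_cell_def by blast
  qed
  show "?R \<subseteq> ?L"
  proof
    fix l assume "l \<in> ?R"
    then obtain h where h: "h \<in> period_lattice"
      and l: "l = map (\<lambda>x. h + x) [\<sigma> *\<^sub>R pos (tail G e), \<sigma> *\<^sub>R (pos (tail G e) + I_edge e)]"
      by (auto simp: jac_cell_def)
    from sign[OF h] obtain \<gamma> where \<gamma>: "\<gamma> \<in> H1_int G" "\<sigma> *\<^sub>R h = I_chain \<gamma>"
      by (auto simp: period_lattice_def)
    from cycle_is_flow_of_closed_walk[OF \<gamma>(1)] obtain q
      where q: "is_walk G (arcs G) b q b" "flow q = \<gamma>" by blast
    have "h = \<sigma> *\<^sub>R \<sigma> *\<^sub>R h" using \<sigma> by auto
    also have "\<sigma> *\<^sub>R h = I_walk q" using \<gamma> q I_walk_walk[OF q(1) subset_refl] by simp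
    finally have "h = \<sigma> *\<^sub>R I_walk q" .
    then have "l = [\<sigma> *\<^sub>R I_walk (q @ p0), \<sigma> *\<^sub>R (I_walk (q @ p0) + I_edge e)]"
      unfolding l pos by (simp add: I_walk_append scaleR_add_right add.assoc)
    moreover have "is_walk G (arcs G) b (q @ p0) (tail G e)"
      using q(1) p0 by (rule is_walk_append)
    ultimately show "l \<in> ?L" unfolding curve_edge_def by blast
  qed
qed

lemma fundamental_chain_eq:
  assumes \<sigma>: "\<sigma> = 1 \<or> \<sigma> = - 1"
  shows "fundamental_chain \<sigma> b = (\<Sum>e\<in>arcs G.
    Poly_Mapping.single (jac_cell [\<sigma> *\<^sub>R pos (tail G e), \<sigma> *\<^sub>R (pos (tail G e) + I_edge e)]) (\<sigma> *\<^sub>R b_edge G e))"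
  unfolding fundamental_chain_def
proof (intro sum.cong refl)
  fix e assume e: "e \<in> arcs G"
  have "direction (curve_edge \<sigma> b e) = \<sigma> *\<^sub>R I_edge e"
    unfolding curve_edge_eq_jac_cell[OF e \<sigma>] direction_jac_cell by (simp add: scaleR_add_right)
  from primitive_tangent_eqI[OF e \<sigma> this] curve_edge_eq_jac_cell[OF e \<sigma>]
  show "Poly_Mapping.single (curve_edge \<sigma> b e) (primitive_tangent (curve_edge \<sigma> b e)) =
    Poly_Mapping.single (jac_cell [\<sigma> *\<^sub>R pos (tail G e), \<sigma> *\<^sub>R (pos (tail G e) + I_edge e)]) (\<sigma> *\<^sub>R b_edge G e)"
    by simp
qed

end


section \<open>Chains as additive extensions of their cells\<close>

text \<open>
  All operators on chains are sums over the support of a chain, of terms that are additive in the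
  coefficient; so they are additive, and determined by their values on cells.
\<close>

lemma additive_sum_keys:
  fixes g :: "'k \<Rightarrow> 'c::ab_group_add \<Rightarrow> 'd::ab_group_add"
  assumes "\<And>P. Modules.additive (g P)"
  shows "Modules.additive (\<lambda>c. \<Sum>P\<in>Poly_Mapping.keys c. g P (Poly_Mapping.lookup c P))"
proof
  fix c d :: "'k \<Rightarrow>\<^sub>0 'c"
  let ?s = "\<lambda>K c. \<Sum>P\<in>K. g P (Poly_Mapping.lookup c P)"
  let ?K = "Poly_Mapping.keys c \<union> Poly_Mapping.keys d"
  have extend: "?s (Poly_Mapping.keys x) x = ?s ?K x" if "Poly_Mapping.keys x \<subseteq> ?K" for x
    using that additive.zero[OF assms]
    by (intro sum.mono_neutral_left) (auto simp: in_keys_iff)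
  have "?s ?K (c + d) = ?s ?K c + ?s ?K d"
    by (simp add: lookup_add additive.add[OF assms] sum.distrib)
  then show "?s (Poly_Mapping.keys (c + d)) (c + d) = ?s (Poly_Mapping.keys c) c + ?s (Poly_Mapping.keys d) d"
    by (simp add: extend Poly_Mapping.keys_add)
qed

lemma sum_keys_single:
  assumes "g P 0 = 0"
  shows "(\<Sum>Q\<in>Poly_Mapping.keys (Poly_Mapping.single P v). g Q (Poly_Mapping.lookup (Poly_Mapping.single P v) Q)) = g P v"
  using assms by (cases "v = 0") auto

lemma single_sum: "(\<Sum>i\<in>I. Poly_Mapping.single P (v i)) = Poly_Mapping.single P (\<Sum>i\<in>I. v i)"
  by (induction I rule: infinite_finite_induct) (auto simp: single_add)

text \<open>
  The faces of faces of a simplex come in pairs of opposite sign.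
\<close>

lemma alternating_faces_cancel:
  fixes w :: "nat \<Rightarrow> nat \<Rightarrow> 'c::real_vector"
  assumes "\<And>i j. j < i \<Longrightarrow> i \<le> Suc q \<Longrightarrow> P i j = P j (i - 1) \<and> w i j = w j (i - 1)"
  shows "(\<Sum>i\<le>Suc q. \<Sum>j\<le>q. Poly_Mapping.single (P i j) ((- 1) ^ (i + j) *\<^sub>R w i j)) = 0"
proof (rule poly_mapping_eqI)
  fix k
  define t where "t = (\<lambda>(i, j). (- 1 :: real) ^ (i + j) *\<^sub>R (w i j when P i j = k))"
  define D where "D = {..Suc q} \<times> {..q}"
  let ?swap = "\<lambda>(i, j). if j < i then (j, i - 1) else (Suc j, i)"
  \<comment> \<open>The face reached by dropping vertex \<open>i\<close> and then \<open>j < i\<close> is reached again from \<open>(j, i - 1)\<close>.\<close>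
  have "(\<Sum>x\<in>D. t x) = (\<Sum>x\<in>D. - t x)"
  proof (rule sum.reindex_bij_witness[of _ ?swap ?swap])
    fix x assume "x \<in> D"
    then obtain i j where x: "x = (i, j)" "i \<le> Suc q" "j \<le> q" by (auto simp: D_def)
    show "?swap (?swap x) = x" "?swap x \<in> D" using x by (auto simp: D_def)
    show "- t (?swap x) = t x"
    proof (cases "j < i")
      case True
      then have "(- 1 :: real) ^ (i + j) = - ((- 1) ^ (j + (i - 1)))"
        by (cases i) (simp_all add: add.commute)
      then show ?thesis using True assms[OF True x(2)] by (simp add: t_def x)
    next
      case False
      then show ?thesis using assms[of i "Suc j"] x by (simp add: t_def add.commute)
    qed
  qed (auto simp: D_def)
  then have "(\<Sum>x\<in>D. t x) = 0"
    by (simp add: sum_negf eq_neg_iff_add_eq_0 flip: scaleR_2)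
  then show "Poly_Mapping.lookup (\<Sum>i\<le>Suc q. \<Sum>j\<le>q. Poly_Mapping.single (P i j) ((- 1) ^ (i + j) *\<^sub>R w i j)) k =
      Poly_Mapping.lookup 0 k"
    by (simp add: D_def t_def lookup_sum lookup_single when_def sum.cartesian_product[symmetric] if_distrib
        cong: if_cong del: sum.atMost_Suc)
qed

lemma wedge_add_left: "wedge (\<alpha> + \<alpha>') \<beta> = wedge \<alpha> \<beta> + wedge \<alpha>' \<beta>"
  and wedge_add_right: "wedge \<alpha> (\<beta> + \<beta>') = wedge \<alpha> \<beta> + wedge \<alpha> \<beta>'"
  and wedge_diff_left: "wedge (\<alpha> - \<alpha>') \<beta> = wedge \<alpha> \<beta> - wedge \<alpha>' \<beta>"
  and wedge_minus_left: "wedge (- \<alpha>) \<beta> = - wedge \<alpha> \<beta>"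
  and wedge_scaleR_left: "wedge (c *\<^sub>R \<alpha>) \<beta> = c *\<^sub>R wedge \<alpha> \<beta>"
  and wedge_scaleR_right: "wedge \<alpha> (c *\<^sub>R \<beta>) = c *\<^sub>R wedge \<alpha> \<beta>"
  and wedge_zero_left: "wedge 0 \<beta> = 0"
  and wedge_zero_right: "wedge \<alpha> 0 = 0"
  and wedge_self: "wedge \<alpha> \<alpha> = 0"
  and wedge_swap: "wedge \<alpha> \<beta> = - wedge \<beta> \<alpha>"
  by (auto simp: wedge_def fun_eq_iff algebra_simps)

lemma wedge_sum_right: "wedge \<alpha> (\<Sum>i\<in>I. \<beta> i) = (\<Sum>i\<in>I. wedge \<alpha> (\<beta> i))"
proof -
  have "Modules.additive (wedge \<alpha>)" by standard (rule wedge_add_right)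
  then show ?thesis by (rule additive.sum)
qed

lemma wedge2_dual_subspace: "subspace (wedge2_dual G)"
  unfolding wedge2_dual_def by (rule subspace_span)

lemma wedge2_dual_diff_closed: "diff_closed (wedge2_dual G)"
  by (rule subspace_diff_closed[OF wedge2_dual_subspace])

lemma wedge_in_wedge2_dual:
  "\<alpha> \<in> Omega_dual G \<Longrightarrow> \<beta> \<in> Omega_dual G \<Longrightarrow> wedge \<alpha> \<beta> \<in> wedge2_dual G"
  unfolding wedge2_dual_def by (intro span_base) blast

context tropical_curve
begin

lemma chains_induct [consumes 1, case_names zero cell add]:
  assumes "c \<in> chains q A"
    and "Q 0"
    and "\<And>xs v. length xs = Suc q \<Longrightarrow> set xs \<subseteq> Omega_dual G \<Longrightarrow> v \<in> A \<Longrightarrow>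
           Q (Poly_Mapping.single (jac_cell xs) v)"
    and "\<And>c d. Q c \<Longrightarrow> Q d \<Longrightarrow> Q (c + d)"
  shows "Q c"
proof -
  have "Q (\<Sum>P\<in>K. Poly_Mapping.single P (Poly_Mapping.lookup c P))"
    if "finite K" "K \<subseteq> Poly_Mapping.keys c" for K
    using that
  proof (induction K)
    case empty
    then show ?case using assms(2) by simp
  next
    case (insert P K)
    then have "P \<in> jac_cells q" using assms(1) by (auto simp: chains_def)
    then obtain xs where "P = jac_cell xs" "length xs = Suc q" "set xs \<subseteq> Omega_dual G"
      by (auto simp: jac_cells_def)
    moreover have "Poly_Mapping.lookup c P \<in> A" using assms(1) by (simp add: chains_def)
    ultimately have "Q (Poly_Mapping.single P (Poly_Mapping.lookup c P))" using assms(3) by blast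
    then show ?case using insert assms(4) by simp
  qed
  moreover have "(\<Sum>P\<in>Poly_Mapping.keys c. Poly_Mapping.single P (Poly_Mapping.lookup c P)) = c"
    by (rule poly_mapping_eqI) (auto simp: lookup_sum lookup_single when_def in_keys_iff)
  ultimately show ?thesis using finite_keys by (metis order_refl)
qed

lemma chains_diff_closed: "diff_closed A \<Longrightarrow> diff_closed (chains q A)"
  unfolding diff_closed_def chains_def
  by (auto simp: lookup_minus dest!: subsetD[OF keys_diff])

lemma chains_cell:
  "length xs = Suc q \<Longrightarrow> set xs \<subseteq> Omega_dual G \<Longrightarrow> v \<in> A \<Longrightarrow> 0 \<in> A \<Longrightarrow>
    Poly_Mapping.single (jac_cell xs) v \<in> chains q A"
  unfolding chains_def jac_cells_def by (auto simp: lookup_single when_def)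

lemma chains_mono: "A \<subseteq> B \<Longrightarrow> chains q A \<subseteq> chains q B"
  unfolding chains_def by blast

lemma facet_jac_cell: "facet i (jac_cell xs) = jac_cell (drop_vertex i xs)"
  unfolding facet_def jac_cell_def drop_vertex_def
  by (simp add: setcompr_eq_image image_image take_map drop_map)

lemma drop_vertex_commute:
  assumes "j < i"
  shows "drop_vertex j (drop_vertex i xs) = drop_vertex (i - 1) (drop_vertex j xs)"
proof -
  obtain k where i: "i = Suc (j + k)" using assms less_imp_Suc_add by blast
  show ?thesis
  proof (cases "j \<le> length xs")
    case True
    then show ?thesis
      by (simp add: drop_vertex_def i take_drop[symmetric] drop_take min_def add.commute)
  next
    case False
    then show ?thesis by (simp add: drop_vertex_def i)
  qed
qed

lemma length_drop_vertex: "i < length xs \<Longrightarrow> length (drop_vertex i xs) = length xs - 1"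
  by (auto simp: drop_vertex_def)

lemma set_drop_vertex: "set (drop_vertex i xs) \<subseteq> set xs"
  unfolding drop_vertex_def using set_take_subset set_drop_subset by fastforce

lemma additive_boundary: "Modules.additive (boundary q)"
proof -
  have "Modules.additive (\<lambda>v::'c::real_vector. \<Sum>i\<le>q. Poly_Mapping.single (facet i P) ((- 1) ^ i *\<^sub>R v))" for P
    by standard (simp add: scaleR_add_right single_add sum.distrib)
  from additive_sum_keys[OF this] show ?thesis unfolding boundary_def .
qed

lemma boundary_cell:
  "boundary q (Poly_Mapping.single (jac_cell xs) v) =
    (\<Sum>i\<le>q. Poly_Mapping.single (jac_cell (drop_vertex i xs)) ((- 1) ^ i *\<^sub>R v))"
  unfolding boundary_def by (subst sum_keys_single) (simp_all add: facet_jac_cell)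

lemma boundary_in_chains:
  assumes A: "diff_closed A" and c: "c \<in> chains (Suc q) A"
  shows "boundary (Suc q) c \<in> chains q A"
  using c
proof (induction rule: chains_induct)
  case zero
  then show ?case
    by (simp add: additive.zero[OF additive_boundary] diff_closed_zero[OF chains_diff_closed[OF A]])
next
  case (cell xs v)
  show ?case
    unfolding boundary_cell
  proof (intro diff_closed_sum chains_diff_closed A chains_cell)
    fix i assume "i \<in> {..Suc q}"
    then show "length (drop_vertex i xs) = Suc q" using cell by (simp add: length_drop_vertex)
    show "set (drop_vertex i xs) \<subseteq> Omega_dual G" using cell set_drop_vertex by blast
    show "(- 1) ^ i *\<^sub>R v \<in> A" using cell A by (intro diff_closed_sign)
    show "0 \<in> A" using diff_closed_zero[OF A] .
  qed
next
  case (add c d)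
  then show ?case
    using diff_closed_add[OF chains_diff_closed[OF A]] by (simp add: additive.add[OF additive_boundary])
qed

lemma boundary_boundary:
  assumes "c \<in> chains (Suc q) A"
  shows "boundary q (boundary (Suc q) c) = 0"
  using assms
proof (induction rule: chains_induct)
  case zero
  then show ?case by (simp add: additive.zero[OF additive_boundary])
next
  case (cell xs v)
  have "boundary q (boundary (Suc q) (Poly_Mapping.single (jac_cell xs) v)) =
      (\<Sum>i\<le>Suc q. \<Sum>j\<le>q. Poly_Mapping.single (jac_cell (drop_vertex j (drop_vertex i xs))) ((- 1) ^ (i + j) *\<^sub>R v))"
    unfolding boundary_cell additive.sum[OF additive_boundary]
    by (simp only: scaleR_scaleR power_add mult.commute)
  also have "\<dots> = 0"
    by (rule alternating_faces_cancel) (simp add: drop_vertex_commute)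
  finally show ?case .
next
  case (add c d)
  then show ?case by (simp add: additive.add[OF additive_boundary])
qed


section \<open>The monodromy operator\<close>

lemma cell_points_in_dual:
  assumes "cell_points pt" "xs \<noteq> []" "set xs \<subseteq> Omega_dual G"
  shows "pt xs \<in> Omega_dual G"
proof -
  have "convex hull (set xs) \<subseteq> Omega_dual G"
    using assms(3) subspace_imp_convex[OF Omega_dual_subspace] by (rule hull_minimal)
  then show ?thesis using assms unfolding cell_points_def by blast
qed

text \<open>
  Vectors attached to a cell are computed on an arbitrarily chosen lift; invariance under periods
  makes the choice irrelevant.
\<close>

lemma lift_invariant:
  assumes "\<And>h. h \<in> period_lattice \<Longrightarrow> f (map (\<lambda>x. h + x) xs) = f xs"
  shows "(let ys = SOME ys. ys \<in> jac_cell xs in f ys) = f xs"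
proof -
  have "(SOME ys. ys \<in> jac_cell xs) \<in> jac_cell xs"
    using in_jac_cell by (rule someI)
  then obtain h where "h \<in> period_lattice" "(SOME ys. ys \<in> jac_cell xs) = map (\<lambda>x. h + x) xs"
    by (auto simp: jac_cell_def)
  then show ?thesis using assms by simp
qed

lemma cell_points_translate:
  assumes "cell_points pt" "xs \<noteq> []" "set xs \<subseteq> Omega_dual G" "h \<in> period_lattice"
  shows "pt (map (\<lambda>x. h + x) xs) = h + pt xs"
  using assms unfolding cell_points_def by blast

lemma displacement_jac_cell:
  assumes pt: "cell_points pt" and xs: "2 \<le> length xs" "i < length xs" "set xs \<subseteq> Omega_dual G"
  shows "displacement pt (jac_cell xs) i = pt xs - pt (drop_vertex i xs)"
  unfolding displacement_def
proof (rule lift_invariant)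
  fix h assume h: "h \<in> period_lattice"
  have "drop_vertex i xs \<noteq> []" using length_drop_vertex[OF xs(2)] xs(1) by auto
  moreover have "set (drop_vertex i xs) \<subseteq> Omega_dual G" using set_drop_vertex xs(3) by blast
  moreover have "drop_vertex i (map (\<lambda>x. h + x) xs) = map (\<lambda>x. h + x) (drop_vertex i xs)"
    by (simp add: drop_vertex_def take_map drop_map)
  moreover have "xs \<noteq> []" using xs by auto
  ultimately show "pt (map (\<lambda>x. h + x) xs) - pt (drop_vertex i (map (\<lambda>x. h + x) xs)) = pt xs - pt (drop_vertex i xs)"
    using cell_points_translate[OF pt _ _ h] xs(3) by simp
qed

lemma additive_monodromy: "Modules.additive (monodromy pt q)"
proof -
  have "Modules.additive (\<lambda>v. \<Sum>i\<le>q. Poly_Mapping.single (facet i P) ((- 1) ^ i *\<^sub>R wedge (displacement pt P i) v))" for P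
    by standard (simp add: wedge_add_right scaleR_add_right single_add sum.distrib)
  from additive_sum_keys[OF this] show ?thesis unfolding monodromy_def .
qed

lemma monodromy_cell:
  assumes "cell_points pt" "length xs = Suc q" "q \<ge> 1" "set xs \<subseteq> Omega_dual G"
  shows "monodromy pt q (Poly_Mapping.single (jac_cell xs) v) =
    (\<Sum>i\<le>q. Poly_Mapping.single (jac_cell (drop_vertex i xs))
      ((- 1) ^ i *\<^sub>R wedge (pt xs - pt (drop_vertex i xs)) v))"
proof -
  have "monodromy pt q (Poly_Mapping.single (jac_cell xs) v) =
    (\<Sum>i\<le>q. Poly_Mapping.single (facet i (jac_cell xs)) ((- 1) ^ i *\<^sub>R wedge (displacement pt (jac_cell xs) i) v))"
    unfolding monodromy_def by (subst sum_keys_single) (simp_all add: wedge_zero_right)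
  also have "\<dots> = (\<Sum>i\<le>q. Poly_Mapping.single (jac_cell (drop_vertex i xs))
      ((- 1) ^ i *\<^sub>R wedge (pt xs - pt (drop_vertex i xs)) v))"
    using assms by (intro sum.cong refl) (simp add: facet_jac_cell displacement_jac_cell)
  finally show ?thesis .
qed

lemma monodromy_in_chains:
  assumes pt: "cell_points pt" and q: "q \<ge> 1" and c: "c \<in> chains q (Omega_dual G)"
  shows "monodromy pt q c \<in> chains (q - 1) (wedge2_dual G)"
  using c
proof (induction rule: chains_induct)
  case zero
  then show ?case
    by (simp add: additive.zero[OF additive_monodromy]
        diff_closed_zero[OF chains_diff_closed[OF wedge2_dual_diff_closed]])
next
  case (cell xs v)
  show ?case
    unfolding monodromy_cell[OF pt cell(1) q cell(2)]
  proof (intro diff_closed_sum chains_diff_closed wedge2_dual_diff_closed chains_cell)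
    fix i assume i: "i \<in> {..q}"
    then show l: "length (drop_vertex i xs) = Suc (q - 1)" using cell q by (simp add: length_drop_vertex)
    show s: "set (drop_vertex i xs) \<subseteq> Omega_dual G" using cell set_drop_vertex by blast
    have "xs \<noteq> []" "drop_vertex i xs \<noteq> []" using l cell(1) by auto
    then have "pt xs - pt (drop_vertex i xs) \<in> Omega_dual G"
      using cell_points_in_dual[OF pt _ s] cell_points_in_dual[OF pt _ cell(2)]
      by (intro diff_closed_diff Omega_dual_diff_closed)
    then show "(- 1) ^ i *\<^sub>R wedge (pt xs - pt (drop_vertex i xs)) v \<in> wedge2_dual G"
      using cell by (intro diff_closed_sign wedge2_dual_diff_closed wedge_in_wedge2_dual)
    show "0 \<in> wedge2_dual G" by (rule diff_closed_zero[OF wedge2_dual_diff_closed])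
  qed
next
  case (add c d)
  then show ?case
    using diff_closed_add[OF chains_diff_closed[OF wedge2_dual_diff_closed]]
    by (simp add: additive.add[OF additive_monodromy])
qed

text \<open>
  On a face of a face of \<open>P\<close>, the two displacements that occur add up to the displacement from
  \<open>P\<close> directly, which does not see the order in which the vertices are dropped. So the faces
  cancel in pairs.
\<close>

lemma boundary_monodromy:
  assumes pt: "cell_points pt" and q: "q \<ge> 1" and c: "c \<in> chains (Suc q) A"
  shows "boundary q (monodromy pt (Suc q) c) + monodromy pt q (boundary (Suc q) c) = 0"
  using c
proof (induction rule: chains_induct)
  case zero
  then show ?case by (simp add: additive.zero[OF additive_boundary] additive.zero[OF additive_monodromy])
next
  case (cell xs v)
  define d where "d = (drop_vertex :: nat \<Rightarrow> 'e covec list \<Rightarrow> _)"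
  have d: "length (d i xs) = Suc q" "set (d i xs) \<subseteq> Omega_dual G" if "i \<le> Suc q" for i
    using that cell set_drop_vertex[of i xs] by (auto simp: length_drop_vertex d_def)
  have "boundary q (monodromy pt (Suc q) (Poly_Mapping.single (jac_cell xs) v)) =
      (\<Sum>i\<le>Suc q. \<Sum>j\<le>q. Poly_Mapping.single (jac_cell (d j (d i xs)))
        ((- 1) ^ (i + j) *\<^sub>R wedge (pt xs - pt (d i xs)) v))"
    using cell unfolding d_def
    by (subst monodromy_cell[OF pt])
      (simp_all only: additive.sum[OF additive_boundary] boundary_cell scaleR_scaleR power_add mult.commute)
  moreover have "monodromy pt q (boundary (Suc q) (Poly_Mapping.single (jac_cell xs) v)) =
      (\<Sum>i\<le>Suc q. \<Sum>j\<le>q. Poly_Mapping.single (jac_cell (d j (d i xs)))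
        ((- 1) ^ (i + j) *\<^sub>R wedge (pt (d i xs) - pt (d j (d i xs))) v))"
    unfolding boundary_cell additive.sum[OF additive_monodromy]
    using d monodromy_cell[OF pt _ q]
    by (intro sum.cong refl) (simp add: d_def wedge_scaleR_right power_add mult.commute)
  ultimately have "boundary q (monodromy pt (Suc q) (Poly_Mapping.single (jac_cell xs) v)) +
      monodromy pt q (boundary (Suc q) (Poly_Mapping.single (jac_cell xs) v)) =
      (\<Sum>i\<le>Suc q. \<Sum>j\<le>q. Poly_Mapping.single (jac_cell (d j (d i xs)))
        ((- 1) ^ (i + j) *\<^sub>R wedge (pt xs - pt (d j (d i xs))) v))"
    by (simp only: sum.distrib[symmetric] single_add[symmetric] scaleR_add_right[symmetric]
        wedge_add_left[symmetric]) simp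
  also have "\<dots> = 0"
    unfolding d_def by (rule alternating_faces_cancel) (simp add: drop_vertex_commute)
  finally show ?case .
next
  case (add c d)
  then show ?case
    by (simp add: additive.add[OF additive_boundary] additive.add[OF additive_monodromy] add_eq_0_iff2 algebra_simps)
qed

text \<open>
  The homotopy between the monodromy operators of two choices of points. It multiplies the
  coefficient of a cell by the vector from the second chosen point to the first.
\<close>

definition point_shift ::
    "('e covec list \<Rightarrow> 'e covec) \<Rightarrow> ('e covec list \<Rightarrow> 'e covec) \<Rightarrow>
     ('e covec list set \<Rightarrow>\<^sub>0 'e covec) \<Rightarrow> ('e covec list set \<Rightarrow>\<^sub>0 'e bivec)" where
  "point_shift pt pt' c = (\<Sum>P\<in>Poly_Mapping.keys c. Poly_Mapping.single P
     (wedge (let xs = SOME xs. xs \<in> P in pt xs - pt' xs) (Poly_Mapping.lookup c P)))"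

lemma additive_point_shift: "Modules.additive (point_shift pt pt')"
proof -
  have "Modules.additive (\<lambda>v. Poly_Mapping.single P (wedge (let xs = SOME xs. xs \<in> P in pt xs - pt' xs) v))" for P
    by standard (simp add: wedge_add_right single_add)
  from additive_sum_keys[OF this] show ?thesis unfolding point_shift_def .
qed

lemma point_shift_cell:
  assumes pt: "cell_points pt" and pt': "cell_points pt'" and xs: "xs \<noteq> []" "set xs \<subseteq> Omega_dual G"
  shows "point_shift pt pt' (Poly_Mapping.single (jac_cell xs) v) =
    Poly_Mapping.single (jac_cell xs) (wedge (pt xs - pt' xs) v)"
proof -
  have "(let ys = SOME ys. ys \<in> jac_cell xs in pt ys - pt' ys) = pt xs - pt' xs"
    by (rule lift_invariant) (simp add: cell_points_translate[OF pt xs] cell_points_translate[OF pt' xs])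
  then show ?thesis
    unfolding point_shift_def by (subst sum_keys_single) (simp_all add: wedge_zero_right)
qed

lemma point_shift_in_chains:
  assumes pt: "cell_points pt" and pt': "cell_points pt'" and c: "c \<in> chains q (Omega_dual G)"
  shows "point_shift pt pt' c \<in> chains q (wedge2_dual G)"
  using c
proof (induction rule: chains_induct)
  case zero
  then show ?case
    by (simp add: additive.zero[OF additive_point_shift]
        diff_closed_zero[OF chains_diff_closed[OF wedge2_dual_diff_closed]])
next
  case (cell xs v)
  then have xs: "xs \<noteq> []" by auto
  show ?case
    unfolding point_shift_cell[OF pt pt' xs cell(2)]
    using cell cell_points_in_dual[OF pt xs cell(2)] cell_points_in_dual[OF pt' xs cell(2)]
    by (intro chains_cell wedge_in_wedge2_dual diff_closed_diff Omega_dual_diff_closed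
        diff_closed_zero wedge2_dual_diff_closed)
next
  case (add c d)
  then show ?case
    using diff_closed_add[OF chains_diff_closed[OF wedge2_dual_diff_closed]]
    by (simp add: additive.add[OF additive_point_shift])
qed

text \<open>
  On the facet \<open>Q\<close> of \<open>P\<close>, the difference of the displacements is the shift of \<open>P\<close> minus the
  shift of \<open>Q\<close>.
\<close>

lemma monodromy_homotopy:
  assumes pt: "cell_points pt" and pt': "cell_points pt'" and c: "c \<in> chains (Suc q) A"
  shows "monodromy pt (Suc q) c - monodromy pt' (Suc q) c =
    boundary (Suc q) (point_shift pt pt' c) - point_shift pt pt' (boundary (Suc q) c)"
  using c
proof (induction rule: chains_induct)
  case zero
  then show ?case
    by (simp add: additive.zero[OF additive_boundary] additive.zero[OF additive_monodromy]
        additive.zero[OF additive_point_shift])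
next
  case (cell xs v)
  have xs: "xs \<noteq> []" using cell by auto
  have d: "drop_vertex i xs \<noteq> []" "set (drop_vertex i xs) \<subseteq> Omega_dual G" if "i \<le> Suc q" for i
    using that cell set_drop_vertex[of i xs] length_drop_vertex[of i xs] by auto
  have "point_shift pt pt' (boundary (Suc q) (Poly_Mapping.single (jac_cell xs) v)) =
      (\<Sum>i\<le>Suc q. Poly_Mapping.single (jac_cell (drop_vertex i xs))
        ((- 1) ^ i *\<^sub>R wedge (pt (drop_vertex i xs) - pt' (drop_vertex i xs)) v))"
    unfolding boundary_cell additive.sum[OF additive_point_shift]
    using d by (intro sum.cong refl) (simp add: point_shift_cell[OF pt pt'] wedge_scaleR_right)
  moreover have "(pt xs - pt (drop_vertex i xs)) - (pt' xs - pt' (drop_vertex i xs)) =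
      (pt xs - pt' xs) - (pt (drop_vertex i xs) - pt' (drop_vertex i xs))" for i by simp
  ultimately show ?case
    using cell
    by (simp only: monodromy_cell[OF pt] monodromy_cell[OF pt'] point_shift_cell[OF pt pt' xs cell(2)] boundary_cell
        sum_subtractf[symmetric] single_diff[symmetric] scaleR_diff_right[symmetric] wedge_diff_left[symmetric]
        le_add1 plus_1_eq_Suc[symmetric])
next
  case (add c d)
  then show ?case
    by (simp add: additive.add[OF additive_boundary] additive.add[OF additive_monodromy]
        additive.add[OF additive_point_shift] algebra_simps)
qed

text \<open>
  With the last vertex as chosen point, a simplex and each facet that contains this vertex have the
  same chosen point, so only one facet contributes to the monodromy.
\<close>

lemma cell_points_last: "cell_points last"
  unfolding cell_points_def by (auto simp: last_map hull_inc)

end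


section \<open>The intermediate Jacobian\<close>

context tropical_curve
begin

lemma cycles_diff_closed: "diff_closed A \<Longrightarrow> diff_closed (cycles q A)"
  using chains_diff_closed[of A q]
  by (auto simp: cycles_def diff_closed_def additive.diff[OF additive_boundary]
      additive.zero[OF additive_boundary])

lemma cycle_group_21_comm_group: "comm_group cycle_group_21"
proof (rule comm_groupI)
  note closed = cycles_diff_closed[OF wedge2_dual_diff_closed, of 1]
  show "\<exists>y\<in>carrier cycle_group_21. y \<otimes>\<^bsub>cycle_group_21\<^esub> x = \<one>\<^bsub>cycle_group_21\<^esub>"
    if "x \<in> carrier cycle_group_21" for x
    using that diff_closed_uminus[OF closed] by (intro bexI[of _ "- x"]) (auto simp: cycle_group_21_def)
qed (use cycles_diff_closed[OF wedge2_dual_diff_closed, of 1] in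
      \<open>auto simp: cycle_group_21_def add_ac intro: diff_closed_add diff_closed_zero\<close>)

lemma inv_cycle_group_21:
  assumes "x \<in> carrier cycle_group_21"
  shows "inv\<^bsub>cycle_group_21\<^esub> x = - x"
proof -
  interpret comm_group cycle_group_21 by (rule cycle_group_21_comm_group)
  have "- x \<in> carrier cycle_group_21"
    using assms diff_closed_uminus[OF cycles_diff_closed[OF wedge2_dual_diff_closed]]
    by (simp add: cycle_group_21_def)
  then show ?thesis using assms by (intro inv_equality) (auto simp: cycle_group_21_def)
qed

lemma boundaries_21_subset: "boundaries_21 \<subseteq> cycles 1 (wedge2_dual G)"
  using boundary_boundary[of _ 1, unfolded Suc_1]
    boundary_in_chains[OF wedge2_dual_diff_closed, of _ 1, unfolded Suc_1]
  unfolding boundaries_21_def cycles_def by blast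

lemma boundaries_21_diff_closed: "diff_closed boundaries_21"
  using chains_diff_closed[OF wedge2_dual_diff_closed, of 2]
  unfolding boundaries_21_def diff_closed_def
  by (force simp: image_iff additive.zero[OF additive_boundary]
      simp flip: additive.diff[OF additive_boundary])

lemma boundaries_21_normal: "boundaries_21 \<lhd> cycle_group_21"
proof -
  interpret comm_group cycle_group_21 by (rule cycle_group_21_comm_group)
  have "subgroup boundaries_21 cycle_group_21"
  proof (rule subgroupI)
    show "boundaries_21 \<subseteq> carrier cycle_group_21"
      using boundaries_21_subset by (simp add: cycle_group_21_def)
    show "boundaries_21 \<noteq> {}" using diff_closed_zero[OF boundaries_21_diff_closed] by blast
    show "inv\<^bsub>cycle_group_21\<^esub> x \<in> boundaries_21" if "x \<in> boundaries_21" for x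
      using that boundaries_21_subset diff_closed_uminus[OF boundaries_21_diff_closed]
      by (subst inv_cycle_group_21) (auto simp: cycle_group_21_def)
    show "x \<otimes>\<^bsub>cycle_group_21\<^esub> y \<in> boundaries_21" if "x \<in> boundaries_21" "y \<in> boundaries_21" for x y
      using that diff_closed_add[OF boundaries_21_diff_closed] by (simp add: cycle_group_21_def)
  qed
  then show ?thesis by (rule subgroup_imp_normal)
qed

lemma H21_group: "group H21"
  unfolding H21_def using boundaries_21_normal by (rule normal.factorgroup_is_group)

lemma H21_class_closed: "c \<in> cycles 1 (wedge2_dual G) \<Longrightarrow> H21_class c \<in> carrier H21"
  unfolding H21_def H21_class_def by (auto simp: FactGroup_def RCOSETS_def cycle_group_21_def)

lemma H21_class_add:
  assumes "c \<in> cycles 1 (wedge2_dual G)" "d \<in> cycles 1 (wedge2_dual G)"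
  shows "H21_class c \<otimes>\<^bsub>H21\<^esub> H21_class d = H21_class (c + d)"
  using normal.rcos_sum[OF boundaries_21_normal, of c d] assms
  by (simp add: H21_def H21_class_def FactGroup_def cycle_group_21_def)

lemma H21_class_zero: "H21_class 0 = \<one>\<^bsub>H21\<^esub>"
proof -
  interpret comm_group cycle_group_21 by (rule cycle_group_21_comm_group)
  have "boundaries_21 #>\<^bsub>cycle_group_21\<^esub> \<one>\<^bsub>cycle_group_21\<^esub> = boundaries_21"
    using boundaries_21_subset by (intro coset_mult_one) (simp add: cycle_group_21_def)
  then show ?thesis by (simp add: H21_def H21_class_def FactGroup_def cycle_group_21_def)
qed

lemma H21_class_eqI:
  assumes "c - d \<in> boundaries_21" "d \<in> cycles 1 (wedge2_dual G)"
  shows "H21_class c = H21_class d"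
proof -
  interpret comm_group cycle_group_21 by (rule cycle_group_21_comm_group)
  have "c \<in> boundaries_21 #>\<^bsub>cycle_group_21\<^esub> d"
    using assms(1) by (auto simp: r_coset_def cycle_group_21_def intro!: bexI[of _ "c - d"])
  from repr_independence[OF this] show ?thesis
    using assms(2) normal_imp_subgroup[OF boundaries_21_normal]
    by (simp add: H21_class_def cycle_group_21_def)
qed

text \<open>Monodromy and boundary anticommute.\<close>

lemma monodromy_cycle:
  assumes pt: "cell_points pt" and c: "c \<in> cycles 2 (Omega_dual_int G)"
  shows "monodromy pt 2 c \<in> cycles 1 (wedge2_dual G)"
proof -
  have chain: "c \<in> chains 2 (Omega_dual G)" and closed: "boundary 2 c = 0"
    using c chains_mono[OF Omega_dual_int_subset] by (auto simp: cycles_def)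
  have "boundary 1 (monodromy pt 2 c) = 0"
    using boundary_monodromy[OF pt order_refl, unfolded Suc_1, OF chain] closed
    by (simp add: additive.zero[OF additive_monodromy])
  moreover have "monodromy pt 2 c \<in> chains (2 - 1) (wedge2_dual G)"
    using chain by (intro monodromy_in_chains pt) auto
  ultimately show ?thesis by (simp add: cycles_def)
qed

lemma L21_subgroup:
  assumes pt: "cell_points pt"
  shows "subgroup (L21 pt) H21"
proof -
  interpret group H21 by (rule H21_group)
  note closed = cycles_diff_closed[OF Omega_dual_int_diff_closed, of 2]
  show ?thesis
  proof (rule subgroupI)
    show "L21 pt \<subseteq> carrier H21"
      unfolding L21_def using monodromy_cycle[OF pt] H21_class_closed by blast
    show "L21 pt \<noteq> {}"
      unfolding L21_def using diff_closed_zero[OF closed] by blast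
    fix x assume "x \<in> L21 pt"
    then obtain \<xi> where \<xi>: "\<xi> \<in> cycles 2 (Omega_dual_int G)" and x: "x = H21_class (monodromy pt 2 \<xi>)"
      by (auto simp: L21_def)
    have \<xi>': "- \<xi> \<in> cycles 2 (Omega_dual_int G)" using \<xi> by (rule diff_closed_uminus[OF closed])
    have "H21_class (monodromy pt 2 (- \<xi>)) \<otimes>\<^bsub>H21\<^esub> x = H21_class 0"
      unfolding x H21_class_add[OF monodromy_cycle[OF pt \<xi>'] monodromy_cycle[OF pt \<xi>]]
      by (simp add: additive.minus[OF additive_monodromy])
    then have "inv\<^bsub>H21\<^esub> x = H21_class (monodromy pt 2 (- \<xi>))"
      unfolding H21_class_zero x
      by (intro inv_equality H21_class_closed monodromy_cycle pt \<xi> \<xi>')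
    then show "inv\<^bsub>H21\<^esub> x \<in> L21 pt" unfolding L21_def using \<xi>' by blast
    fix y assume "y \<in> L21 pt"
    then obtain \<eta> where \<eta>: "\<eta> \<in> cycles 2 (Omega_dual_int G)" and y: "y = H21_class (monodromy pt 2 \<eta>)"
      by (auto simp: L21_def)
    have "x \<otimes>\<^bsub>H21\<^esub> y = H21_class (monodromy pt 2 (\<xi> + \<eta>))"
      unfolding x y H21_class_add[OF monodromy_cycle[OF pt \<xi>] monodromy_cycle[OF pt \<eta>]]
      by (simp add: additive.add[OF additive_monodromy])
    then show "x \<otimes>\<^bsub>H21\<^esub> y \<in> L21 pt"
      unfolding L21_def using diff_closed_add[OF closed \<xi> \<eta>] by blast
  qed
qed

text \<open>
  Two integral fillings of the Ceresa cycle differ by an integral cycle, whose monodromy lies in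
  \<^const>\<open>L21\<close> by definition. So one filling determines the Ceresa class.
\<close>

lemma ceresa_class_eqI:
  assumes pt: "cell_points pt"
    and \<xi>: "\<xi> \<in> chains 2 (Omega_dual_int G)" "boundary 2 \<xi> = ceresa_cycle b"
    and c: "c \<in> cycles 1 (wedge2_dual G)" "monodromy pt 2 \<xi> - c \<in> boundaries_21"
  shows "ceresa_class pt b = JH21_class pt (H21_class c)"
  unfolding ceresa_class_def
proof (rule the_equality)
  interpret group H21 by (rule H21_group)
  have class_\<xi>: "H21_class (monodromy pt 2 \<xi>) = H21_class c"
    using c(2,1) by (rule H21_class_eqI)
  have "c + (monodromy pt 2 \<xi> - c) \<in> cycles 1 (wedge2_dual G)"
    using c boundaries_21_subset
    by (intro diff_closed_add[OF cycles_diff_closed[OF wedge2_dual_diff_closed]]) auto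
  then have mon_\<xi>: "monodromy pt 2 \<xi> \<in> cycles 1 (wedge2_dual G)" by simp
  have "JH21_class pt (H21_class c) \<in> carrier (JH21 pt)"
    unfolding JH21_class_def JH21_def using H21_class_closed[OF c(1)]
    by (auto simp: FactGroup_def RCOSETS_def)
  then show "JH21_class pt (H21_class c) \<in> carrier (JH21 pt) \<and> (\<exists>\<xi>\<in>chains 2 (Omega_dual_int G).
      boundary 2 \<xi> = ceresa_cycle b \<and>
      JH21_class pt (H21_class c) = JH21_class pt (H21_class (monodromy pt 2 \<xi>)))"
    using \<xi> class_\<xi> by metis
  fix d assume "d \<in> carrier (JH21 pt) \<and> (\<exists>\<xi>\<in>chains 2 (Omega_dual_int G).
      boundary 2 \<xi> = ceresa_cycle b \<and> d = JH21_class pt (H21_class (monodromy pt 2 \<xi>)))"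
  then obtain \<zeta> where \<zeta>: "\<zeta> \<in> chains 2 (Omega_dual_int G)" "boundary 2 \<zeta> = ceresa_cycle b"
    and d: "d = JH21_class pt (H21_class (monodromy pt 2 \<zeta>))" by blast
  have diff: "\<zeta> - \<xi> \<in> cycles 2 (Omega_dual_int G)"
    using \<zeta> \<xi> diff_closed_diff[OF chains_diff_closed[OF Omega_dual_int_diff_closed]]
    by (simp add: cycles_def additive.diff[OF additive_boundary])
  have "H21_class (monodromy pt 2 (\<zeta> - \<xi>)) \<otimes>\<^bsub>H21\<^esub> H21_class (monodromy pt 2 \<xi>) =
      H21_class (monodromy pt 2 \<zeta>)"
    unfolding H21_class_add[OF monodromy_cycle[OF pt diff] mon_\<xi>]
    by (simp add: additive.diff[OF additive_monodromy])
  moreover have "H21_class (monodromy pt 2 (\<zeta> - \<xi>)) \<in> L21 pt"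
    unfolding L21_def using diff by blast
  ultimately have "H21_class (monodromy pt 2 \<zeta>) \<in> L21 pt #>\<^bsub>H21\<^esub> H21_class (monodromy pt 2 \<xi>)"
    unfolding r_coset_def by blast
  from repr_independence[OF this H21_class_closed[OF mon_\<xi>] L21_subgroup[OF pt]]
  show "d = JH21_class pt (H21_class c)"
    unfolding d JH21_class_def class_\<xi>[symmetric] by (rule sym)
qed


section \<open>A filling of the Ceresa cycle\<close>

abbreviation cell :: "'e covec list \<Rightarrow> 'c::real_vector \<Rightarrow> 'e covec list set \<Rightarrow>\<^sub>0 'c" where
  "cell xs v \<equiv> Poly_Mapping.single (jac_cell xs) v"

lemma cell_translate:
  "h \<in> period_lattice \<Longrightarrow> cell [h + x, h + y] v = cell [x, y] v"
  "h \<in> period_lattice \<Longrightarrow> cell [h + x] v = cell [x] v"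
  by (intro arg_cong2[of _ _ _ _ Poly_Mapping.single] jac_cell_eqI[of h] refl; simp)+

lemma boundary_triangle:
  "boundary 2 (cell [x, y, z] v) = cell [y, z] v - cell [x, z] v + cell [x, y] v"
  unfolding boundary_cell
  by (simp add: numeral_2_eq_2 drop_vertex_def single_uminus)

lemma boundary_segment: "boundary 1 (cell [x, y] v) = cell [y] v - cell [x] v"
  unfolding boundary_cell by (simp add: drop_vertex_def single_uminus)

lemma monodromy_last_triangle:
  assumes "x \<in> Omega_dual G" "y \<in> Omega_dual G" "z \<in> Omega_dual G"
  shows "monodromy last 2 (cell [x, y, z] v) = cell [x, y] (wedge (z - y) v)"
  using assms
  by (subst monodromy_cell[OF cell_points_last])
    (simp_all add: numeral_2_eq_2 drop_vertex_def wedge_zero_left)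

text \<open>
  The edge \<open>[a, 0]\<close> of the first triangle is a translate of \<open>[0, - a]\<close>; the second triangle
  removes the degenerate edge \<open>[0, 0]\<close>.
\<close>

lemma boundary_loop_and_reverse:
  assumes "a \<in> period_lattice"
  shows "boundary 2 (cell [0, a, 0] v + cell [0, 0, 0] v) = cell [0, a] v + cell [0, - a] v"
proof -
  have "cell [a, 0] v = cell [0, - a] v"
    using cell_translate(1)[OF assms, of 0 "- a" v] by simp
  then show ?thesis
    by (simp add: additive.add[OF additive_boundary] boundary_triangle)
qed

text \<open>
  The edge \<open>[a, a + y]\<close> is a translate of \<open>[0, y]\<close>. So a segment to \<open>a + y\<close> is homologous to the
  loop \<open>a\<close> followed by a segment to \<open>y\<close>.
\<close>

lemma boundary_loop_then_segment:
  assumes "a \<in> period_lattice"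
  shows "boundary 2 (cell [0, a, a + y] v) = cell [0, y] v - cell [0, a + y] v + cell [0, a] v"
  using cell_translate(1)[OF assms, of 0 y v] by (simp add: boundary_triangle)

lemma tensor_cycle_in_cycles:
  assumes "a \<in> period_lattice" "w \<in> wedge2_dual G"
  shows "tensor_cycle a w \<in> cycles 1 (wedge2_dual G)"
proof -
  have "cell [a] w = cell [0] w" using cell_translate(2)[OF assms(1), of 0 w] by simp
  then have "boundary 1 (cell [0, a] w) = 0" unfolding boundary_segment by simp
  moreover have "cell [0, a] w \<in> chains 1 (wedge2_dual G)"
    using assms period_lattice_subset diff_closed_zero[OF Omega_dual_diff_closed]
      diff_closed_zero[OF wedge2_dual_diff_closed]
    by (intro chains_cell) auto
  ultimately show ?thesis by (simp add: tensor_cycle_def cycles_def)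
qed

text \<open>
  Both chosen points lie on the edge, so the shift between them is parallel to the coefficient.
\<close>

lemma point_shift_parallel_edge:
  assumes pt: "cell_points pt" and pt': "cell_points pt'"
    and "x \<in> Omega_dual G" "y \<in> Omega_dual G" "y - x = c *\<^sub>R v"
  shows "point_shift pt pt' (cell [x, y] v) = 0"
proof -
  have seg: "\<exists>r. p [x, y] = x + r *\<^sub>R v" if "cell_points p" for p
  proof -
    have "p [x, y] \<in> convex hull {x, y}"
      using that assms(3,4) unfolding cell_points_def by (metis empty_set empty_subsetI insert_subset list.distinct(1) list.simps(15))
    then obtain u where "p [x, y] = x + u *\<^sub>R (y - x)"
      by (auto simp: segment_convex_hull[symmetric] closed_segment_def algebra_simps)
    then show ?thesis using assms(5) by auto
  qed
  obtain r r' where "pt [x, y] = x + r *\<^sub>R v" "pt' [x, y] = x + r' *\<^sub>R v"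
    using seg[OF pt] seg[OF pt'] by blast
  then have "pt [x, y] - pt' [x, y] = (r - r') *\<^sub>R v" by (simp add: algebra_simps)
  then have "wedge (pt [x, y] - pt' [x, y]) v = 0" by (simp only: wedge_scaleR_left wedge_self) simp
  then show ?thesis using assms(3,4) by (subst point_shift_cell[OF pt pt']) simp_all
qed

end

context tropical_curve_with_tree
begin

lemma ceresa_cycle_eq:
  "ceresa_cycle b = (\<Sum>e\<in>arcs G.
     cell [pos (tail G e), pos (tail G e) + I_edge e] (b_edge G e) +
     cell [- pos (tail G e), - (pos (tail G e) + I_edge e)] (b_edge G e))"
  unfolding ceresa_cycle_def fundamental_chain_eq[of 1, simplified] fundamental_chain_eq[of "- 1", simplified]
  by (simp add: single_uminus sum_negf sum.distrib)

text \<open>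
  A filling of \<open>[s, s + I] + [- s, - s - I]\<close> for one edge, up to terms that cancel at the
  vertices: cones from \<open>0\<close> over both segments; the end \<open>s + I = a + y\<close> of a cone is moved along
  the period \<open>a\<close> to the image \<open>y\<close> of the head; and the loops \<open>a\<close> and \<open>- a\<close> that this leaves
  cancel each other.
\<close>

definition edge_filling :: "'e \<Rightarrow> 'e covec list set \<Rightarrow>\<^sub>0 'e covec" where
  "edge_filling e = (let s = pos (tail G e); a = gap e; y = pos (head G e); v = b_edge G e in
     cell [0, s, s + I_edge e] v + cell [0, - s, - (s + I_edge e)] v
     - (cell [0, a, a + y] v + cell [0, - a, - a + - y] v)
     + (cell [0, a, 0] v + cell [0, 0, 0] v))"

lemma gap_plus_pos: "gap e + pos (head G e) = pos (tail G e) + I_edge e"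
  by (simp add: gap_def)

lemma edge_vectors_in_dual:
  assumes "e \<in> arcs G"
  shows "pos (tail G e) \<in> Omega_dual G" "pos (head G e) \<in> Omega_dual G" "gap e \<in> Omega_dual G"
    "I_edge e \<in> Omega_dual G" "0 \<in> Omega_dual G"
  using assms pos_in_dual gap_period period_lattice_subset I_edge_in_dual
    diff_closed_zero[OF Omega_dual_diff_closed] by auto

lemmas dual_intros =
  diff_closed_add[OF Omega_dual_diff_closed] diff_closed_uminus[OF Omega_dual_diff_closed]
  diff_closed_diff[OF Omega_dual_diff_closed]

lemma edge_filling_in_chains:
  assumes "e \<in> arcs G"
  shows "edge_filling e \<in> chains 2 (Omega_dual_int G)"
proof -
  note closed = chains_diff_closed[OF Omega_dual_int_diff_closed]
  have triangle: "cell [x, y, z] (b_edge G e) \<in> chains 2 (Omega_dual_int G)"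
    if "x \<in> Omega_dual G" "y \<in> Omega_dual G" "z \<in> Omega_dual G" for x y z
    using that b_edge_integral diff_closed_zero[OF Omega_dual_int_diff_closed]
    by (intro chains_cell) auto
  then show ?thesis
    unfolding edge_filling_def Let_def
    by (intro diff_closed_add[OF closed] diff_closed_diff[OF closed] triangle dual_intros
        edge_vectors_in_dual[OF assms])
qed

lemma boundary_edge_filling:
  assumes "e \<in> arcs G"
  shows "boundary 2 (edge_filling e) =
    cell [pos (tail G e), pos (tail G e) + I_edge e] (b_edge G e) +
    cell [- pos (tail G e), - (pos (tail G e) + I_edge e)] (b_edge G e) +
    (cell [0, pos (tail G e)] (b_edge G e) - cell [0, pos (head G e)] (b_edge G e)) +
    (cell [0, - pos (tail G e)] (b_edge G e) - cell [0, - pos (head G e)] (b_edge G e))"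
proof -
  have a: "gap e \<in> period_lattice" "- gap e \<in> period_lattice"
    using gap_period[OF assms] diff_closed_uminus[OF period_lattice_diff_closed] by auto
  have e: "gap e + pos (head G e) = pos (tail G e) + I_edge e"
    "- gap e + - pos (head G e) = - (pos (tail G e) + I_edge e)"
    by (auto simp: gap_def)
  have "boundary 2 (edge_filling e) =
      boundary 2 (cell [0, pos (tail G e), pos (tail G e) + I_edge e] (b_edge G e)) +
      boundary 2 (cell [0, - pos (tail G e), - (pos (tail G e) + I_edge e)] (b_edge G e)) -
      (boundary 2 (cell [0, gap e, gap e + pos (head G e)] (b_edge G e)) +
       boundary 2 (cell [0, - gap e, - gap e + - pos (head G e)] (b_edge G e))) +
      boundary 2 (cell [0, gap e, 0] (b_edge G e) + cell [0, 0, 0] (b_edge G e))"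
    by (simp only: edge_filling_def Let_def additive.add[OF additive_boundary]
        additive.diff[OF additive_boundary])
  then show ?thesis
    unfolding boundary_loop_and_reverse[OF a(1)]
      boundary_loop_then_segment[OF a(1)] boundary_loop_then_segment[OF a(2)]
    unfolding boundary_triangle e by simp
qed

text \<open>
  Regrouped by vertices, the coefficients of \<open>[0, f v]\<close> add up to the sum of the outgoing
  functionals at \<open>v\<close> minus the sum of the incoming ones, which vanishes on harmonic forms.
\<close>

lemma vertex_terms_cancel:
  "(\<Sum>e\<in>arcs G. cell [0, f (tail G e)] (b_edge G e) - cell [0, f (head G e)] (b_edge G e)) = 0"
proof -
  have regroup: "(\<Sum>e\<in>arcs G. cell [0, f (t e)] (b_edge G e)) =
      (\<Sum>v\<in>verts G. cell [0, f v] (\<Sum>e | e \<in> arcs G \<and> t e = v. b_edge G e))"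
    if "t ` arcs G \<subseteq> verts G" for t
  proof -
    have "(\<Sum>v\<in>verts G. cell [0, f v] (\<Sum>e | e \<in> arcs G \<and> t e = v. b_edge G e)) =
      (\<Sum>v\<in>verts G. \<Sum>e | e \<in> arcs G \<and> t e = v. cell [0, f (t e)] (b_edge G e))"
      unfolding single_sum[symmetric] by (intro sum.cong refl) auto
    also have "\<dots> = (\<Sum>e\<in>arcs G. cell [0, f (t e)] (b_edge G e))"
      using that by (intro sum.group) auto
    finally show ?thesis ..
  qed
  have "tail G ` arcs G \<subseteq> verts G" "head G ` arcs G \<subseteq> verts G" by auto
  then show ?thesis
    by (simp add: sum_subtractf regroup sum_b_edge_at_vertex)
qed

lemma boundary_filling:
  "boundary 2 (\<Sum>e\<in>arcs G. edge_filling e) = ceresa_cycle b"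
proof -
  have "boundary 2 (\<Sum>e\<in>arcs G. edge_filling e) = ceresa_cycle b +
    (\<Sum>e\<in>arcs G. cell [0, pos (tail G e)] (b_edge G e) - cell [0, pos (head G e)] (b_edge G e)) +
    (\<Sum>e\<in>arcs G. cell [0, - pos (tail G e)] (b_edge G e) - cell [0, - pos (head G e)] (b_edge G e))"
    unfolding additive.sum[OF additive_boundary] ceresa_cycle_eq sum.distrib[symmetric]
    by (intro sum.cong refl boundary_edge_filling)
  then show ?thesis
    using vertex_terms_cancel[of pos] vertex_terms_cancel[of "\<lambda>v. - pos v"] by simp
qed

lemma filling_in_chains: "(\<Sum>e\<in>arcs G. edge_filling e) \<in> chains 2 (Omega_dual_int G)"
  by (intro diff_closed_sum chains_diff_closed Omega_dual_int_diff_closed edge_filling_in_chains)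

text \<open>
  The cones contribute nothing, because the last edge of such a triangle is parallel to its
  coefficient. The remaining triangles leave \<open>- (a + y) \<and> v\<close> on the loop \<open>a\<close> and \<open>y \<and> v\<close> on the loop
  \<open>- a\<close>. Moving the latter to \<open>a\<close> as well gives \<open>- (a + 2 y) \<and> v\<close>, and \<open>a + y = s + I\<close>, where \<open>I\<close>
  is parallel to \<open>v\<close>.
\<close>

lemma monodromy_edge_filling:
  assumes "e \<in> arcs G"
  shows "monodromy last 2 (edge_filling e) -
      tensor_cycle (gap e) (wedge (b_edge G e) (pos (tail G e) + pos (head G e))) \<in> boundaries_21"
proof -
  let ?y = "pos (head G e)" and ?s = "pos (tail G e)" and ?a = "gap e" and ?v = "b_edge G e"
  note D = edge_vectors_in_dual[OF assms]
  have a: "?a \<in> period_lattice" by (rule gap_period[OF assms])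
  have parallel: "wedge (I_edge e) ?v = 0"
    by (simp add: I_edge_def wedge_scaleR_left wedge_self)
  have opposite: "- (wedge ?a ?v + wedge ?y ?v + wedge ?y ?v) = wedge ?v (?s + ?y)"
  proof -
    have "wedge ?a ?v + wedge ?y ?v + wedge ?y ?v = wedge (?a + ?y) ?v + wedge ?y ?v"
      by (simp only: wedge_add_left)
    also have "\<dots> = wedge (?s + ?y) ?v"
      by (simp only: gap_plus_pos wedge_add_left parallel) simp
    finally show ?thesis using wedge_swap[of ?v "?s + ?y"] by simp
  qed
  have "monodromy last 2 (edge_filling e) =
      cell [0, ?s] (wedge (I_edge e) ?v) + cell [0, - ?s] (wedge (- I_edge e) ?v)
      - (cell [0, ?a] (wedge ?y ?v) + cell [0, - ?a] (wedge (- ?y) ?v))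
      + (cell [0, ?a] (wedge (- ?a) ?v) + cell [0, 0] (wedge 0 ?v))"
    unfolding edge_filling_def Let_def
    using D
    by (simp add: additive.add[OF additive_monodromy] additive.diff[OF additive_monodromy]
        monodromy_last_triangle dual_intros)
  also have "\<dots> = cell [0, ?a] (wedge (- ?a) ?v) - cell [0, ?a] (wedge ?y ?v) + cell [0, - ?a] (wedge ?y ?v)"
    unfolding wedge_minus_left parallel wedge_zero_left by (simp add: single_uminus)
  also have "\<dots> = cell [0, ?a] (wedge ?v (?s + ?y)) +
      (cell [0, ?a] (wedge ?y ?v) + cell [0, - ?a] (wedge ?y ?v))"
    by (simp only: opposite[symmetric] wedge_minus_left single_uminus single_add) simp
  finally have "monodromy last 2 (edge_filling e) - tensor_cycle ?a (wedge ?v (?s + ?y)) =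
      boundary 2 (cell [0, ?a, 0] (wedge ?y ?v) + cell [0, 0, 0] (wedge ?y ?v))"
    by (simp add: tensor_cycle_def boundary_loop_and_reverse[OF a])
  moreover have "cell [0, ?a, 0] (wedge ?y ?v) + cell [0, 0, 0] (wedge ?y ?v) \<in> chains 2 (wedge2_dual G)"
    using D b_edge_in_dual diff_closed_zero[OF wedge2_dual_diff_closed]
    by (intro diff_closed_add[OF chains_diff_closed[OF wedge2_dual_diff_closed]] chains_cell wedge_in_wedge2_dual)
      auto
  ultimately show ?thesis unfolding boundaries_21_def by (intro image_eqI)
qed

lemma tensor_cycle_0_boundary:
  assumes "w \<in> wedge2_dual G"
  shows "tensor_cycle 0 w \<in> boundaries_21"
proof -
  have "tensor_cycle 0 w = boundary 2 (cell [0, 0, 0] w)"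
    by (simp add: tensor_cycle_def boundary_triangle)
  moreover have "cell [0, 0, 0] w \<in> chains 2 (wedge2_dual G)"
    using assms diff_closed_zero[OF Omega_dual_diff_closed] diff_closed_zero[OF wedge2_dual_diff_closed]
    by (intro chains_cell) auto
  ultimately show ?thesis unfolding boundaries_21_def by (intro image_eqI)
qed

lemma point_shift_ceresa_cycle:
  assumes "cell_points pt" "cell_points pt'"
  shows "point_shift pt pt' (ceresa_cycle b) = 0"
  unfolding ceresa_cycle_eq additive.sum[OF additive_point_shift] additive.add[OF additive_point_shift]
proof (intro sum.neutral ballI)
  fix e assume "e \<in> arcs G"
  note D = edge_vectors_in_dual[OF this]
  have "point_shift pt pt' (cell [pos (tail G e), pos (tail G e) + I_edge e] (b_edge G e)) = 0"
    using D by (intro point_shift_parallel_edge[OF assms, of _ _ "len e"] dual_intros) (auto simp: I_edge_def)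
  moreover have "point_shift pt pt' (cell [- pos (tail G e), - (pos (tail G e) + I_edge e)] (b_edge G e)) = 0"
    using D by (intro point_shift_parallel_edge[OF assms, of _ _ "- len e"] dual_intros) (auto simp: I_edge_def)
  ultimately show "point_shift pt pt' (cell [pos (tail G e), pos (tail G e) + I_edge e] (b_edge G e)) +
    point_shift pt pt' (cell [- pos (tail G e), - (pos (tail G e) + I_edge e)] (b_edge G e)) = 0" by simp
qed

definition tree_formula :: "'e covec list set \<Rightarrow>\<^sub>0 'e bivec" where
  "tree_formula = (\<Sum>e\<in>F. \<Sum>\<epsilon>\<in>arcs G - F.
     tensor_cycle (a_cycle F \<epsilon>) ((tree_sign G F b e \<epsilon> * len e) *\<^sub>R wedge (b_edge G \<epsilon>) (b_edge G e)))"

text \<open>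
  The coefficient of \<open>b_edge e\<close> in \<open>pos v\<close> is \<open>len e\<close> times the flow through \<open>e\<close> of the tree path to
  \<open>v\<close>.
\<close>

lemma tree_formula_eq:
  "tree_formula = (\<Sum>\<epsilon>\<in>arcs G - F.
     tensor_cycle (gap \<epsilon>) (wedge (b_edge G \<epsilon>) (pos (tail G \<epsilon>) + pos (head G \<epsilon>))))"
  unfolding tree_formula_def
proof (subst sum.swap, intro sum.cong refl)
  fix \<epsilon> assume "\<epsilon> \<in> arcs G - F"
  then have \<epsilon>: "\<epsilon> \<in> arcs G" and V: "tail G \<epsilon> \<in> verts G" "head G \<epsilon> \<in> verts G" by auto
  have "pos (tail G \<epsilon>) + pos (head G \<epsilon>) = (\<Sum>e\<in>F. (tree_sign G F b e \<epsilon> * len e) *\<^sub>R b_edge G e)"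
    unfolding pos_eq_sum_tree[OF V(1)] pos_eq_sum_tree[OF V(2)] sum.distrib[symmetric]
    by (intro sum.cong refl) (simp add: tree_sign_eq_flow[OF _ \<epsilon>] algebra_simps)
  then show "(\<Sum>e\<in>F. tensor_cycle (a_cycle F \<epsilon>) ((tree_sign G F b e \<epsilon> * len e) *\<^sub>R wedge (b_edge G \<epsilon>) (b_edge G e))) =
    tensor_cycle (gap \<epsilon>) (wedge (b_edge G \<epsilon>) (pos (tail G \<epsilon>) + pos (head G \<epsilon>)))"
    by (simp add: tensor_cycle_def single_sum a_cycle_eq_gap[OF \<epsilon>] wedge_sum_right wedge_scaleR_right)
qed

lemma edge_bivector:
  "e \<in> arcs G \<Longrightarrow> wedge (b_edge G e) (pos (tail G e) + pos (head G e)) \<in> wedge2_dual G"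
  by (intro wedge_in_wedge2_dual b_edge_in_dual dual_intros edge_vectors_in_dual)

lemma tree_formula_cycle: "tree_formula \<in> cycles 1 (wedge2_dual G)"
  unfolding tree_formula_eq
  by (intro diff_closed_sum cycles_diff_closed wedge2_dual_diff_closed tensor_cycle_in_cycles
      gap_period edge_bivector) auto

lemma monodromy_filling:
  assumes pt: "cell_points pt"
  shows "monodromy pt 2 (\<Sum>e\<in>arcs G. edge_filling e) - tree_formula \<in> boundaries_21"
proof -
  let ?\<xi> = "\<Sum>e\<in>arcs G. edge_filling e"
  let ?t = "\<lambda>e. tensor_cycle (gap e) (wedge (b_edge G e) (pos (tail G e) + pos (head G e)))"
  note closed = boundaries_21_diff_closed
  have \<xi>: "?\<xi> \<in> chains 2 (Omega_dual G)"
    using filling_in_chains chains_mono[OF Omega_dual_int_subset] by blast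
  have "monodromy pt 2 ?\<xi> - monodromy last 2 ?\<xi> = boundary 2 (point_shift pt last ?\<xi>)"
    using monodromy_homotopy[OF pt cell_points_last, of _ 1, unfolded Suc_1, OF \<xi>]
    by (simp add: boundary_filling point_shift_ceresa_cycle[OF pt cell_points_last])
  then have 1: "monodromy pt 2 ?\<xi> - monodromy last 2 ?\<xi> \<in> boundaries_21"
    unfolding boundaries_21_def
    using point_shift_in_chains[OF pt cell_points_last \<xi>] by simp
  have "(\<Sum>e\<in>arcs G. monodromy last 2 (edge_filling e) - ?t e) \<in> boundaries_21"
    by (intro diff_closed_sum closed monodromy_edge_filling)
  then have 2: "monodromy last 2 ?\<xi> - (\<Sum>e\<in>arcs G. ?t e) \<in> boundaries_21"
    by (simp add: additive.sum[OF additive_monodromy] sum_subtractf)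
  have "(\<Sum>e\<in>arcs G. ?t e) = (\<Sum>e\<in>F. ?t e) + tree_formula"
    unfolding tree_formula_eq using sum.subset_diff[OF F_arcs finite_arcs] by (simp add: add.commute)
  moreover have "(\<Sum>e\<in>F. ?t e) \<in> boundaries_21"
    using F_arcs by (intro diff_closed_sum closed) (auto simp: gap_tree intro!: tensor_cycle_0_boundary edge_bivector)
  ultimately have 3: "(\<Sum>e\<in>arcs G. ?t e) - tree_formula \<in> boundaries_21" by simp
  \<comment> \<open>change of the chosen points, the computation for last vertices, removal of the tree edges\<close>
  from diff_closed_add[OF closed diff_closed_add[OF closed 1 2] 3] show ?thesis by simp
qed

lemma ceresa_class_eq_tree_formula:
  assumes "cell_points pt"
  shows "ceresa_class pt b = JH21_class pt (H21_class tree_formula)"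
  using ceresa_class_eqI[OF assms filling_in_chains boundary_filling tree_formula_cycle
      monodromy_filling[OF assms]] .

end

theorem theorem6p4:
  fixes G :: "('v, 'e) pre_digraph"
    and len :: "'e \<Rightarrow> real"
    and pt :: "'e covec list \<Rightarrow> 'e covec"
    and b :: 'v
    and F :: "'e set"
  assumes "tropical_curve G len"
    and "tropical_curve.cell_points G len pt"
    and "b \<in> verts G"
    and "is_spanning_tree G F"
  shows "tropical_curve.ceresa_class G len pt b =
    tropical_curve.JH21_class G len pt
      (tropical_curve.H21_class G len
        (\<Sum>e\<in>F. \<Sum>\<epsilon>\<in>arcs G - F.
          tropical_curve.tensor_cycle G len
            (tropical_curve.a_cycle G len F \<epsilon>)
            ((tree_sign G F b e \<epsilon> * len e) *\<^sub>R wedge (b_edge G \<epsilon>) (b_edge G e))))"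
proof -
  interpret tropical_curve G len by fact
  interpret tropical_curve_with_tree G len F b
    using assms(3,4) by unfold_locales
  show ?thesis
    using ceresa_class_eq_tree_formula[OF assms(2)] unfolding tree_formula_def .
qed

end
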